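(* Let $\mathfrak g$ be a left-symmetric algebra over $\mathbb F$. For each of the following four conditions, $\mathfrak g$ is complete if and only if the condition holds for all $x\in\mathfrak g$: (a) $R(x)$ is nilpotent; (b) $P(x)=1$; (c) $P(x)\neq 0$; (d) $\operatorname{Tr}R(x)=0$.
   Context: All algebras are finite dimensional over $\mathbb F=\mathbb R$ or $\mathbb F=\mathbb C$. A left-symmetric algebra is a vector space $\mathfrak g$ with a bilinear product such that $x(yz)-(xy)z=y(xz)-(yx)z$ for all $x,y,z$. $R(x)$ denotes right multiplication, $R(x)y=yx$, as a linear operator on $\mathfrak g$, and $P(x)=\det(I+R(x))$, where $I$ is the identity operator of $\mathfrak g$. Completeness: each $x\in\mathfrak g$ defines the affine vector field $F_x(y)=xy+x$ on the vector space $\mathfrak g$; these fields form a Lie algebra of affine vector fields. Let $G$ be the corresponding connected Lie group of affine transformations of $\mathfrak g$ (generated by the flows of the fields $F_x$). The algebra $\mathfrak g$ is complete if $G$ acts transitively on $\mathfrak g$. *)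

theory Defs
  imports "Complex_Main" "Jordan_Normal_Form.Determinant"
begin

definition nilpotent_op :: "('v::zero \<Rightarrow> 'v) \<Rightarrow> bool" where
  "nilpotent_op f \<longleftrightarrow> (\<exists>k. \<forall>v. (f ^^ k) v = 0)"

locale finite_dim_space = vector_space scale
  for scale :: "'a::field \<Rightarrow> 'b::ab_group_add \<Rightarrow> 'b" +
  assumes finite_dim: "\<exists>B. finite B \<and> span B = UNIV"
begin

definition is_ordered_basis :: "'b list \<Rightarrow> bool" where
  "is_ordered_basis bs \<longleftrightarrow> distinct bs \<and> independent (set bs) \<and> span (set bs) = UNIV"

lemma ex_ordered_basis: "\<exists>bs. is_ordered_basis bs"
proof -
  obtain S where S: "finite S" "span S = UNIV"
    using finite_dim by blast
  obtain B where B: "B \<subseteq> S" "independent B" "S \<subseteq> span B"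
    using maximal_independent_subset by blast
  have "finite B"
    using B(1) S(1) finite_subset by blast
  then obtain bs where "set bs = B" "distinct bs"
    using finite_distinct_list by blast
  moreover have "span B = UNIV"
    using B(3) S(2) span_minimal[OF _ subspace_span, of S B] by blast
  ultimately show ?thesis
    using B(2) unfolding is_ordered_basis_def by blast
qed

definition matrix_wrt :: "'b list \<Rightarrow> ('b \<Rightarrow> 'b) \<Rightarrow> 'a mat" where
  "matrix_wrt bs f =
     mat (length bs) (length bs) (\<lambda>(i, j). representation (set bs) (f (bs ! j)) (bs ! i))"

text \<open>
  Determinant and trace of a linear operator on a finite-dimensional space, computed in some
  ordered basis; for linear operators the values do not depend on the basis chosen.
\<close>

definition op_det :: "('b \<Rightarrow> 'b) \<Rightarrow> 'a" where
  "op_det f = det (matrix_wrt (SOME bs. is_ordered_basis bs) f)"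

definition op_trace :: "('b \<Rightarrow> 'b) \<Rightarrow> 'a" where
  "op_trace f = (let A = matrix_wrt (SOME bs. is_ordered_basis bs) f
                 in \<Sum>i<dim_row A. A $$ (i, i))"

end

locale left_symmetric_algebra = finite_dim_space scale
  for scale :: "'f::real_normed_field \<Rightarrow> 'v::ab_group_add \<Rightarrow> 'v" (infixr "\<cdot>" 75) +
  fixes mul :: "'v \<Rightarrow> 'v \<Rightarrow> 'v" (infixl "\<star>" 70)
  assumes mul_linear_right: "Vector_Spaces.linear scale scale (\<lambda>y. x \<star> y)"
    and mul_linear_left: "Vector_Spaces.linear scale scale (\<lambda>x. x \<star> y)"
    and left_symmetric: "x \<star> (y \<star> z) - (x \<star> y) \<star> z = y \<star> (x \<star> z) - (y \<star> x) \<star> z"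
begin

definition R :: "'v \<Rightarrow> 'v \<Rightarrow> 'v" where
  "R x y = y \<star> x"

definition P :: "'v \<Rightarrow> 'f" where
  "P x = op_det (\<lambda>y. y + R x y)"

definition F :: "'v \<Rightarrow> 'v \<Rightarrow> 'v" where
  "F x y = x \<star> y + x"

text \<open>
  The space carries no norm. A curve is differentiated with respect to the canonical topology
  of a finite-dimensional space, that is, after composition with every linear functional
  (equivalently, coordinatewise). The time parameter is real for either scalar field: the complex
  one-parameter groups are covered because \<open>F (c \<cdot> x) = (\<lambda>y. c \<cdot> F x y)\<close>.
\<close>

definition has_velocity :: "(real \<Rightarrow> 'v) \<Rightarrow> 'v \<Rightarrow> real \<Rightarrow> bool" where
  "has_velocity \<gamma> v t \<longleftrightarrow>
     (\<forall>l. Vector_Spaces.linear scale (*) l \<longrightarrow> ((\<lambda>s. l (\<gamma> s)) has_vector_derivative l v) (at t))"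

definition is_flow :: "('v \<Rightarrow> 'v) \<Rightarrow> (real \<Rightarrow> 'v \<Rightarrow> 'v) \<Rightarrow> bool" where
  "is_flow X \<phi> \<longleftrightarrow>
     (\<forall>p. \<phi> 0 p = p \<and> (\<forall>t. has_velocity (\<lambda>s. \<phi> s p) (X (\<phi> t p)) t))"

text \<open>
  The connected Lie group belonging to the Lie algebra of the fields \<open>F x\<close>: the group of
  transformations generated by their flows.
\<close>

inductive_set G :: "('v \<Rightarrow> 'v) set" where
  flow: "is_flow (F x) \<phi> \<Longrightarrow> \<phi> t \<in> G"
| ident: "id \<in> G"
| comp: "g \<in> G \<Longrightarrow> h \<in> G \<Longrightarrow> g \<circ> h \<in> G"
| inverse: "g \<in> G \<Longrightarrow> inv_into UNIV g \<in> G"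

definition complete :: bool where
  "complete \<longleftrightarrow> (\<forall>p q. \<exists>g\<in>G. g p = q)"

end

end

theory Submission
  imports
    "HOL-Analysis.Urysohn"
    "HOL-Analysis.Derivative"
    "Jordan_Normal_Form.Char_Poly"
    Defs
begin

text \<open>
  Let \<open>L(x)\<close> and \<open>R(x)\<close> be the left and right multiplications. The velocities \<open>F x y = (I + R(y)) x\<close> of
  the affine fields at a point \<open>y\<close> fill the whole space exactly if \<open>P y \<noteq> 0\<close>, so \<open>P\<close> detects the open
  orbits of \<open>G\<close>. Everything rests on one formula: left-symmetry turns the derivative of \<open>I + R(y)\<close>
  along \<open>F x\<close> into \<open>(I + R(y)) R(x)\<close> plus the commutator of \<open>L(x)\<close> and \<open>I + R(y)\<close>, and Jacobi's formula
  then gives \<open>P' = tr R(x) * P\<close> along \<open>F x\<close> (\<open>has_vector_derivative_P\<close>).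

  If the algebra is complete, every point lies in the orbit of \<open>0\<close>. By the formula every element of
  \<open>G\<close> preserves the set where \<open>P \<noteq> 0\<close>, and \<open>P 0 = 1\<close>, so \<open>P\<close> has no zeros
  (\<open>P_nonzero_if_complete\<close>). Conversely, if \<open>P\<close> has no zeros, every point has a neighbourhood that is
  reached from it by time-one flows (\<open>flow_reaches_neighbourhood\<close>); orbits are therefore open, and the
  real line through two points lies in a single orbit (\<open>complete_if_P_nonzero\<close>).

  The decisive step is that a zero-free \<open>P\<close> forces all traces \<open>tr R(x)\<close> to vanish
  (\<open>trace_zero_if_P_nonzero\<close>). Over the complex numbers a zero-free polynomial is constant, but over
  the reals another reason is needed. Every field \<open>F x\<close> has an integral curve that is polynomial in the
  time: on the part of the space where \<open>L(x)\<close> is invertible one can start at a zero of the field, and on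
  the remaining part \<open>L(x)\<close> is nilpotent and the exponential series breaks off. On this curve \<open>P\<close> is a
  polynomial and, by the formula, a nonzero multiple of \<open>exp (t * tr R(x))\<close>, so \<open>tr R(x) = 0\<close>.

  The rest is linear algebra. If all traces vanish, the formula says that the gradient of \<open>P\<close> is zero
  wherever \<open>P\<close> is not, so the polynomial \<open>P\<close> is constant, equal to \<open>P 0 = 1\<close>
  (\<open>P_one_if_trace_zero\<close>). If \<open>det (I + s R(x)) = 1\<close> for all scalars \<open>s\<close>, then \<open>R(x)\<close> is nilpotent
  (\<open>nilpotent_if_P_one\<close>), and if \<open>R(x)\<close> is nilpotent, then \<open>I + R(x)\<close> is injective
  (\<open>P_nonzero_if_nilpotent\<close>).
\<close>

section \<open>Coordinates and matrices of linear operators\<close>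

context finite_dim_space
begin

abbreviation lin :: "('b \<Rightarrow> 'b) \<Rightarrow> bool" where
  "lin \<equiv> Vector_Spaces.linear scale scale"

text \<open>
  This is the basis in which \<open>op_det\<close> and \<open>op_trace\<close> are evaluated, so both can be computed in
  coordinates without appealing to their invariance under a change of basis.
\<close>

definition basis :: "'b list" where "basis = (SOME bs. is_ordered_basis bs)"

definition rank :: nat where "rank = length basis"

definition crd :: "nat \<Rightarrow> 'b \<Rightarrow> 'a" where
  "crd i v = representation (set basis) v (basis ! i)"

definition from_crd :: "(nat \<Rightarrow> 'a) \<Rightarrow> 'b" where
  "from_crd f = (\<Sum>i<rank. scale (f i) (basis ! i))"

lemma basis: "distinct basis" "independent (set basis)" "span (set basis) = UNIV"
proof -
  have "is_ordered_basis basis"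
    unfolding basis_def by (rule someI_ex) (rule ex_ordered_basis)
  then show "distinct basis" "independent (set basis)" "span (set basis) = UNIV"
    unfolding is_ordered_basis_def by auto
qed

lemma lin_iff: "lin f \<longleftrightarrow> (\<forall>x y. f (x + y) = f x + f y) \<and> (\<forall>c x. f (scale c x) = scale c (f x))"
  using vector_space_axioms unfolding Vector_Spaces.linear_iff by auto

lemma functional_iff:
  "Vector_Spaces.linear scale (*) l \<longleftrightarrow>
     (\<forall>x y. l (x + y) = l x + l y) \<and> (\<forall>c x. l (scale c x) = c * l x)"
proof -
  have "vector_space ((*) :: 'a \<Rightarrow> 'a \<Rightarrow> 'a)"
    by unfold_locales (auto simp: algebra_simps)
  then show ?thesis using vector_space_axioms unfolding Vector_Spaces.linear_iff by auto
qed

lemma crd_add [simp]: "crd i (x + y) = crd i x + crd i y"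
  unfolding crd_def by (subst representation_add) (use basis in auto)

lemma crd_scale [simp]: "crd i (scale c x) = c * crd i x"
  unfolding crd_def by (subst representation_scale) (use basis in auto)

lemma crd_0 [simp]: "crd i 0 = 0"
  using crd_scale[of i 0 0] by simp

lemma crd_minus [simp]: "crd i (- x) = - crd i x"
  using crd_add[of i x "- x"] by (simp add: eq_neg_iff_add_eq_0 add.commute)

lemma crd_diff [simp]: "crd i (x - y) = crd i x - crd i y"
  using crd_add[of i x "- y"] by simp

lemma crd_sum [simp]: "crd i (sum f S) = (\<Sum>s\<in>S. crd i (f s))"
  by (induction S rule: infinite_finite_induct) auto

lemma crd_basis: "i < rank \<Longrightarrow> j < rank \<Longrightarrow> crd i (basis ! j) = (if i = j then 1 else 0)"
  unfolding crd_def rank_def using basis by (auto simp: representation_basis nth_eq_iff_index_eq)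

lemma from_crd_crd: "from_crd (\<lambda>i. crd i v) = v"
proof -
  have "v = (\<Sum>b\<in>set basis. scale (representation (set basis) v b) b)"
    by (rule sum_representation_eq[symmetric]) (use basis in auto)
  also have "\<dots> = (\<Sum>i<rank. scale (crd i v) (basis ! i))"
    unfolding crd_def rank_def
    by (rule sum.reindex_bij_betw[symmetric, OF bij_betw_nth]) (use basis in auto)
  finally show ?thesis by (simp add: from_crd_def)
qed

lemma crd_from_crd [simp]: "i < rank \<Longrightarrow> crd i (from_crd f) = f i"
  unfolding from_crd_def by (simp add: crd_basis if_distrib[of "(*) _"] sum.delta cong: if_cong)

lemma crd_eqI: "(\<And>i. i < rank \<Longrightarrow> crd i v = crd i w) \<Longrightarrow> v = w"
  by (subst from_crd_crd[of v, symmetric], subst from_crd_crd[of w, symmetric]) (simp add: from_crd_def)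

lemma functional_sum:
  "Vector_Spaces.linear scale (*) l \<Longrightarrow> l v = (\<Sum>i<rank. crd i v * l (basis ! i))"
proof -
  assume l: "Vector_Spaces.linear scale (*) l"
  have l0: "l 0 = 0" using l functional_iff by (metis add_cancel_right_right add_0)
  have *: "l (sum g S) = (\<Sum>s\<in>S. l (g s))" for g and S :: "nat set"
    by (induction S rule: infinite_finite_induct) (use l functional_iff l0 in auto)
  have "l v = l (from_crd (\<lambda>i. crd i v))" by (simp add: from_crd_crd)
  also have "\<dots> = (\<Sum>i<rank. crd i v * l (basis ! i))"
    unfolding from_crd_def * using l functional_iff by auto
  finally show ?thesis .
qed

lemma crd_functional: "Vector_Spaces.linear scale (*) (crd i)"
  unfolding functional_iff by simp

lemma crd_lin:
  assumes "lin f"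
  shows "crd i (f v) = (\<Sum>j<rank. crd i (f (basis ! j)) * crd j v)"
proof -
  have "Vector_Spaces.linear scale (*) (\<lambda>v. crd i (f v))"
    using assms unfolding lin_iff functional_iff by simp
  from functional_sum[OF this, of v] show ?thesis by (simp add: mult.commute)
qed

definition mtx :: "('b \<Rightarrow> 'b) \<Rightarrow> 'a mat" where "mtx = matrix_wrt basis"

lemma mtx_carrier [simp]: "mtx f \<in> carrier_mat rank rank" "dim_row (mtx f) = rank" "dim_col (mtx f) = rank"
  unfolding mtx_def matrix_wrt_def rank_def by auto

lemma mtx_index [simp]: "i < rank \<Longrightarrow> j < rank \<Longrightarrow> mtx f $$ (i, j) = crd i (f (basis ! j))"
  unfolding mtx_def matrix_wrt_def rank_def crd_def by auto

lemma op_det_mtx: "op_det f = det (mtx f)"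
  unfolding op_det_def mtx_def basis_def ..

lemma op_trace_mtx: "op_trace f = (\<Sum>i<rank. mtx f $$ (i, i))"
  unfolding op_trace_def basis_def[symmetric] mtx_def[symmetric] by (simp add: Let_def)

lemma mtx_mult: "lin f \<Longrightarrow> mtx (\<lambda>v. f (g v)) = mtx f * mtx g"
  by (rule eq_matI) (auto simp: scalar_prod_def crd_lin[of f _ "g _"] lessThan_atLeast0)

lemma mtx_plus: "mtx (\<lambda>v. f v + g v) = mtx f + mtx g"
  by (rule eq_matI) auto

lemma mtx_minus: "mtx (\<lambda>v. f v - g v) = mtx f - mtx g"
  by (rule eq_matI) auto

lemma mtx_id: "mtx (\<lambda>v. v) = 1\<^sub>m rank"
  by (rule eq_matI) (auto simp: crd_basis)

lemma op_det_id: "op_det (\<lambda>v. v) = 1"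
  by (simp add: op_det_mtx mtx_id)

lemma op_det_nonzero_inverse:
  assumes f: "lin f" and det: "op_det f \<noteq> 0"
  obtains g where "lin g" "\<And>v. f (g v) = v"
proof -
  define B where "B = adj_mat (mtx f)"
  have B: "B \<in> carrier_mat rank rank" "mtx f * B = op_det f \<cdot>\<^sub>m 1\<^sub>m rank"
    unfolding B_def op_det_mtx using adj_mat[of "mtx f" rank] by auto
  define g where "g v = from_crd (\<lambda>j. \<Sum>l<rank. B $$ (j, l) * crd l v / op_det f)" for v
  have "lin g" unfolding lin_iff
    by (auto intro!: crd_eqI
        simp: g_def sum.distrib[symmetric] sum_distrib_left algebra_simps add_divide_distrib)
  moreover have "f (g v) = v" for v
  proof (rule crd_eqI)
    fix i assume i: "i < rank"
    have "crd i (f (g v)) = (\<Sum>j<rank. \<Sum>l<rank. mtx f $$ (i, j) * B $$ (j, l) * crd l v / op_det f)"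
      using i unfolding crd_lin[OF f, of i "g v"] 
      by (simp add: g_def sum_distrib_left mult.assoc)
    also have "\<dots> = (\<Sum>l<rank. (mtx f * B) $$ (i, l) * crd l v / op_det f)"
      using i B(1) by (subst sum.swap) (simp add: scalar_prod_def sum_distrib_right sum_divide_distrib lessThan_atLeast0)
    also have "\<dots> = crd i v"
      using i det unfolding B(2) by (simp add: if_distrib[of "\<lambda>x. x * _ / _"] if_distrib[of "\<lambda>x. _ * x"] sum.delta cong: if_cong)
    finally show "crd i (f (g v)) = crd i v" .
  qed
  ultimately show ?thesis using that by blast
qed

lemma op_det_nonzero_injective:
  assumes f: "lin f" and inj: "\<And>v. f v = 0 \<Longrightarrow> v = 0"
  shows "op_det f \<noteq> 0"
proof
  assume "op_det f = 0"
  then obtain w where w: "w \<in> carrier_vec rank" "w \<noteq> 0\<^sub>v rank" "mtx f *\<^sub>v w = 0\<^sub>v rank"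
    unfolding op_det_mtx by (metis det_0_iff_vec_prod_zero mtx_carrier(1))
  define v where "v = from_crd (\<lambda>i. vec_index w i)"
  have "f v = 0"
  proof (rule crd_eqI)
    fix i assume i: "i < rank"
    have "crd i (f v) = vec_index (mtx f *\<^sub>v w) i"
      using i w(1) unfolding crd_lin[OF f, of i v]
      by (auto simp: v_def scalar_prod_def lessThan_atLeast0)
    then show "crd i (f v) = crd i 0" using w i by simp
  qed
  then have "v = 0" by (rule inj)
  have "w = 0\<^sub>v rank"
  proof (rule eq_vecI)
    fix i assume "i < dim_vec (0\<^sub>v rank)"
    then have i: "i < rank" by simp
    then have "vec_index w i = crd i v" by (simp add: v_def)
    then show "vec_index w i = vec_index (0\<^sub>v rank) i" using \<open>v = 0\<close> i by simp
  qed (use w in auto)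
  with w show False by simp
qed

end

section \<open>The derivative of a determinant\<close>

text \<open>
  Jacobi's formula. By the Leibniz formula and the product rule, the derivative of the determinant
  is the sum over \<open>i\<close> of the determinants in which row \<open>i\<close> alone is differentiated; expanding the
  \<open>i\<close>-th one along row \<open>i\<close> gives the cofactors.
\<close>

lemma has_vector_derivative_det:
  fixes a :: "nat \<Rightarrow> nat \<Rightarrow> real \<Rightarrow> 'f::real_normed_field"
  assumes a: "\<And>i j. i < n \<Longrightarrow> j < n \<Longrightarrow> (a i j has_vector_derivative a' i j) (at t)"
  shows "((\<lambda>s. det (mat n n (\<lambda>(i, j). a i j s))) has_vector_derivative
           (\<Sum>i<n. \<Sum>j<n. a' i j * cofactor (mat n n (\<lambda>(i, j). a i j t)) i j)) (at t)"
proof -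
  let ?S = "{p. p permutes {0..<n}}"
  define A where "A s = mat n n (\<lambda>(i, j). a i j s)" for s
  define E where "E i = mat n n (\<lambda>(k, j). if k = i then a' i j else a k j t)" for i
  have p_lt: "p k < n" if "p \<in> ?S" "k < n" for p k
    using that permutes_in_image[of p "{0..<n}" k] by auto
  have det_A: "det (A s) = (\<Sum>p\<in>?S. signof p * (\<Prod>i=0..<n. a i (p i) s))" for s
    unfolding A_def by (subst det_def'[of _ n]) (auto intro!: sum.cong prod.cong simp: p_lt)
  have det_E: "det (E i) = (\<Sum>p\<in>?S. signof p * (a' i (p i) * (\<Prod>k\<in>{0..<n} - {i}. a k (p k) t)))"
    if i: "i < n" for i
  proof -
    have "det (E i) = (\<Sum>p\<in>?S. signof p * (\<Prod>k=0..<n. if k = i then a' i (p k) else a k (p k) t))"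
      unfolding E_def by (subst det_def'[of _ n]) (auto intro!: sum.cong prod.cong simp: p_lt)
    also have "\<dots> = (\<Sum>p\<in>?S. signof p * (a' i (p i) * (\<Prod>k\<in>{0..<n} - {i}. a k (p k) t)))"
    proof (intro sum.cong refl arg_cong2[of _ _ _ _ "(*)"])
      fix p
      have "(\<Prod>k=0..<n. if k = i then a' i (p k) else a k (p k) t) = a' i (p i) *
          (\<Prod>k\<in>{0..<n} - {i}. if k = i then a' i (p k) else a k (p k) t)"
        by (subst prod.remove[of _ i]) (use i in auto)
      then show "(\<Prod>k=0..<n. if k = i then a' i (p k) else a k (p k) t) = a' i (p i) *
          (\<Prod>k\<in>{0..<n} - {i}. a k (p k) t)"
        by simp
    qed
    finally show ?thesis .
  qed
  have "((\<lambda>s. \<Sum>p\<in>?S. signof p * (\<Prod>i=0..<n. a i (p i) s)) has_derivative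
          (\<lambda>y. \<Sum>p\<in>?S. signof p * (\<Sum>i=0..<n. (y *\<^sub>R a' i (p i)) * (\<Prod>k\<in>{0..<n} - {i}. a k (p k) t)))) (at t)"
  proof (rule has_derivative_sum)
    fix p assume p: "p \<in> ?S"
    have "((\<lambda>s. \<Prod>i=0..<n. a i (p i) s) has_derivative
        (\<lambda>y. \<Sum>i=0..<n. (y *\<^sub>R a' i (p i)) * (\<Prod>k\<in>{0..<n} - {i}. a k (p k) t))) (at t)"
      by (rule has_derivative_prod) (use a p_lt[OF p] in \<open>simp add: has_vector_derivative_def\<close>)
    then show "((\<lambda>s. signof p * (\<Prod>i=0..<n. a i (p i) s)) has_derivative
        (\<lambda>y. signof p * (\<Sum>i=0..<n. (y *\<^sub>R a' i (p i)) * (\<Prod>k\<in>{0..<n} - {i}. a k (p k) t)))) (at t)"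
      by (rule has_derivative_mult_right)
  qed
  also have "(\<lambda>y. \<Sum>p\<in>?S. signof p * (\<Sum>i=0..<n. (y *\<^sub>R a' i (p i)) * (\<Prod>k\<in>{0..<n} - {i}. a k (p k) t)))
      = (\<lambda>y. y *\<^sub>R (\<Sum>i<n. det (E i)))"
  proof
    fix y
    have "(\<Sum>p\<in>?S. signof p * (\<Sum>i=0..<n. (y *\<^sub>R a' i (p i)) * (\<Prod>k\<in>{0..<n} - {i}. a k (p k) t)))
      = (\<Sum>i=0..<n. \<Sum>p\<in>?S. y *\<^sub>R (signof p * (a' i (p i) * (\<Prod>k\<in>{0..<n} - {i}. a k (p k) t))))"
      by (subst sum.swap) (simp add: sum_distrib_left)
    also have "\<dots> = y *\<^sub>R (\<Sum>i<n. det (E i))"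
      by (simp add: scaleR_sum_right det_E lessThan_atLeast0)
    finally show "(\<Sum>p\<in>?S. signof p * (\<Sum>i=0..<n. (y *\<^sub>R a' i (p i)) * (\<Prod>k\<in>{0..<n} - {i}. a k (p k) t)))
      = y *\<^sub>R (\<Sum>i<n. det (E i))" .
  qed
  also have "(\<lambda>s. \<Sum>p\<in>?S. signof p * (\<Prod>i=0..<n. a i (p i) s)) = (\<lambda>s. det (A s))"
    by (simp add: det_A)
  also have "(\<Sum>i<n. det (E i)) = (\<Sum>i<n. \<Sum>j<n. a' i j * cofactor (A t) i j)"
  proof (rule sum.cong[OF refl])
    fix i assume "i \<in> {..<n}"
    then have i: "i < n" by simp
    have "det (E i) = (\<Sum>j<n. E i $$ (i, j) * cofactor (E i) i j)"
      by (rule laplace_expansion_row) (use i in \<open>auto simp: E_def\<close>)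
    also have "\<dots> = (\<Sum>j<n. a' i j * cofactor (A t) i j)"
    proof (rule sum.cong[OF refl])
      fix j assume "j \<in> {..<n}"
      then have "mat_delete (E i) i j = mat_delete (A t) i j"
        unfolding mat_delete_def E_def A_def by (intro eq_matI) (use i in auto)
      then show "E i $$ (i, j) * cofactor (E i) i j = a' i j * cofactor (A t) i j"
        using i \<open>j \<in> {..<n}\<close> by (simp add: cofactor_def E_def)
    qed
    finally show "det (E i) = (\<Sum>j<n. a' i j * cofactor (A t) i j)" .
  qed
  finally show ?thesis unfolding has_vector_derivative_def A_def .
qed

definition mat_trace :: "'a::comm_ring_1 mat \<Rightarrow> 'a" where
  "mat_trace A = (\<Sum>i<dim_row A. A $$ (i, i))"

lemma mat_trace_comm:
  assumes "A \<in> carrier_mat n n" "B \<in> carrier_mat n n"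
  shows "mat_trace (A * B) = mat_trace (B * A)"
proof -
  have "mat_trace (A * B) = (\<Sum>i<n. \<Sum>j<n. A $$ (i, j) * B $$ (j, i))"
    using assms by (auto simp: mat_trace_def scalar_prod_def lessThan_atLeast0)
  also have "\<dots> = (\<Sum>j<n. \<Sum>i<n. B $$ (j, i) * A $$ (i, j))"
    by (subst sum.swap) (simp add: mult.commute)
  also have "\<dots> = mat_trace (B * A)"
    using assms by (auto simp: mat_trace_def scalar_prod_def lessThan_atLeast0)
  finally show ?thesis .
qed

lemma mat_trace_smult: "A \<in> carrier_mat n n \<Longrightarrow> mat_trace (c \<cdot>\<^sub>m A) = c * mat_trace A"
  by (auto simp: mat_trace_def sum_distrib_left)

lemma mat_trace_add:
  "A \<in> carrier_mat n n \<Longrightarrow> B \<in> carrier_mat n n \<Longrightarrow> mat_trace (A + B) = mat_trace A + mat_trace B"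
  by (auto simp: mat_trace_def sum.distrib)

lemma mat_trace_minus:
  "A \<in> carrier_mat n n \<Longrightarrow> B \<in> carrier_mat n n \<Longrightarrow> mat_trace (A - B) = mat_trace A - mat_trace B"
  by (auto simp: mat_trace_def sum_subtractf)

text \<open>
  With Jacobi's formula this says that a matrix curve with \<open>A' = A M + L A - A L\<close> satisfies
  \<open>(det A)' = det A * tr M\<close>: after multiplication by the adjugate, the two terms with \<open>L\<close> both have
  trace \<open>det A * tr L\<close>.
\<close>

lemma trace_adjugate:
  fixes A :: "'a::comm_ring_1 mat"
  assumes A: "A \<in> carrier_mat n n" and M: "M \<in> carrier_mat n n" and L: "L \<in> carrier_mat n n"
  shows "(\<Sum>i<n. \<Sum>j<n. (A * M + L * A - A * L) $$ (i, j) * cofactor A i j) = det A * mat_trace M"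
proof -
  define C where "C = adj_mat A"
  have C: "C \<in> carrier_mat n n" "A * C = det A \<cdot>\<^sub>m 1\<^sub>m n" "C * A = det A \<cdot>\<^sub>m 1\<^sub>m n"
    unfolding C_def by (rule adj_mat[OF A])+
  let ?D = "A * M + L * A - A * L"
  have D: "?D \<in> carrier_mat n n"
    by (intro minus_carrier_mat mult_carrier_mat[OF A L])
  have AC: "mat_trace (A * X * C) = det A * mat_trace X" if X: "X \<in> carrier_mat n n" for X
  proof -
    have "mat_trace (A * X * C) = mat_trace (C * (A * X))"
      by (rule mat_trace_comm) (use A C X in auto)
    also have "C * (A * X) = det A \<cdot>\<^sub>m X"
      using A C X mult_smult_assoc_mat[of "1\<^sub>m n" n n X n "det A"]
      by (simp add: assoc_mult_mat[symmetric])
    finally show ?thesis using X by (simp add: mat_trace_smult)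
  qed
  have "(\<Sum>i<n. \<Sum>j<n. ?D $$ (i, j) * cofactor A i j) = mat_trace (?D * C)"
    using A D L by (auto simp: mat_trace_def scalar_prod_def C_def adj_mat_def lessThan_atLeast0)
  also have "?D * C = A * M * C + L * A * C - A * L * C"
    using minus_mult_distrib_mat[of "A * M + L * A" n n "A * L" C n]
      add_mult_distrib_mat[of "A * M" n n "L * A" C n] A C M L by simp
  also have "mat_trace \<dots> = mat_trace (A * M * C) + mat_trace (L * A * C) - mat_trace (A * L * C)"
    using A C M L
    by (subst mat_trace_minus[of _ n], auto)
      (subst mat_trace_add[of _ n], auto simp: assoc_mult_mat[of _ n n _ n _ n])
  also have "L * A * C = det A \<cdot>\<^sub>m L"
    using A C L mult_smult_distrib[of L n n "1\<^sub>m n" n "det A"] by (simp add: assoc_mult_mat)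
  finally show ?thesis
    using L M by (simp add: AC mat_trace_smult)
qed

section \<open>The polynomial P along integral curves\<close>

context left_symmetric_algebra
begin

lemma mul_add_left: "(x + y) \<star> z = x \<star> z + y \<star> z"
  and mul_add_right: "x \<star> (y + z) = x \<star> y + x \<star> z"
  and mul_scale_left: "(c \<cdot> x) \<star> z = c \<cdot> (x \<star> z)"
  and mul_scale_right: "x \<star> (c \<cdot> z) = c \<cdot> (x \<star> z)"
  using mul_linear_left mul_linear_right unfolding lin_iff by blast+

lemma lin_R: "lin (R x)" and lin_one_plus_R: "lin (\<lambda>y. y + R x y)"
  unfolding lin_iff R_def by (auto simp: mul_add_left mul_scale_left scale_right_distrib algebra_simps)

lemma F_eq: "F x y = x + R y x"
  by (simp add: F_def R_def add.commute)

lemma P_zero: "P 0 = 1"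
proof -
  have "x \<star> 0 = 0" for x using mul_scale_right[of x 0 0] by simp
  then show ?thesis unfolding P_def R_def using op_det_id by simp
qed

text \<open>
  This is left-symmetry, written as the identity \<open>R(F x y) = A R(x) + L A - A L\<close> of operators in \<open>z\<close>,
  where \<open>A = I + R(y)\<close> and \<open>L\<close> is left multiplication by \<open>x\<close>.
\<close>

lemma R_F:
  "z \<star> F x y = (z \<star> x + R y (z \<star> x)) + x \<star> (z + R y z) - (x \<star> z + R y (x \<star> z))"
  using left_symmetric[of z x y]
  by (simp add: F_def R_def mul_add_left mul_add_right algebra_simps)

text \<open>
  By \<open>R_F\<close> and \<open>trace_adjugate\<close>, \<open>P\<close> is a relative invariant of the flows of the affine fields: along
  an integral curve of \<open>F x\<close> it is multiplied by \<open>exp (t * tr R(x))\<close>. The hypothesis concerns a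
  single time \<open>t\<close>, so that the formula applies to a straight line as well as to an integral curve.
\<close>

lemma has_vector_derivative_P:
  assumes v: "has_velocity \<gamma> (F x (\<gamma> t)) t"
  shows "((\<lambda>s. P (\<gamma> s)) has_vector_derivative (P (\<gamma> t) * op_trace (R x))) (at t)"
proof -
  define y where "y = \<gamma> t"
  define A where "A s = mtx (\<lambda>z. z + R (\<gamma> s) z)" for s
  have A_mat: "A s = mat rank rank (\<lambda>(i, j). crd i (basis ! j + basis ! j \<star> \<gamma> s))" for s
    unfolding A_def by (rule eq_matI) (auto simp: R_def)
  have der: "((\<lambda>s. crd i (basis ! j + basis ! j \<star> \<gamma> s)) has_vector_derivative
      crd i (basis ! j \<star> F x y)) (at t)" for i j
  proof -
    have "Vector_Spaces.linear scale (*) (\<lambda>v. crd i (basis ! j \<star> v))"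
      unfolding functional_iff by (simp add: mul_add_right mul_scale_right)
    then have "((\<lambda>s. crd i (basis ! j \<star> \<gamma> s)) has_vector_derivative crd i (basis ! j \<star> F x y)) (at t)"
      using v unfolding has_velocity_def y_def by blast
    then show ?thesis
      by (auto intro!: derivative_eq_intros)
  qed
  define D where "D = mtx (\<lambda>z. z \<star> F x y)"
  have D: "D = A t * mtx (R x) + mtx (\<lambda>z. x \<star> z) * A t - A t * mtx (\<lambda>z. x \<star> z)"
  proof -
    have "D = mtx (\<lambda>z. (\<lambda>w. w + R y w) (R x z) + x \<star> (z + R y z) - (\<lambda>w. w + R y w) (x \<star> z))"
      unfolding D_def by (rule arg_cong[of _ _ mtx]) (simp add: R_F fun_eq_iff, simp add: R_def)
    then show ?thesis
      using mtx_mult[OF lin_one_plus_R[of y], of "R x"] mtx_mult[OF lin_one_plus_R[of y], of "\<lambda>z. x \<star> z"]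
        mtx_mult[OF mul_linear_right[of x], of "\<lambda>z. z + R y z"]
      by (simp only: mtx_plus mtx_minus A_def y_def)
  qed
  have "((\<lambda>s. det (A s)) has_vector_derivative
      (\<Sum>i<rank. \<Sum>j<rank. crd i (basis ! j \<star> F x y) * cofactor (A t) i j)) (at t)"
    unfolding A_mat by (rule has_vector_derivative_det) (rule der)
  also have "(\<Sum>i<rank. \<Sum>j<rank. crd i (basis ! j \<star> F x y) * cofactor (A t) i j)
      = (\<Sum>i<rank. \<Sum>j<rank. D $$ (i, j) * cofactor (A t) i j)"
    by (simp add: D_def)
  also have "\<dots> = det (A t) * mat_trace (mtx (R x))"
    unfolding D by (rule trace_adjugate) (simp_all add: A_def)
  also have "mat_trace (mtx (R x)) = op_trace (R x)"
    by (simp add: mat_trace_def op_trace_mtx)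
  finally show ?thesis
    by (simp add: A_def P_def op_det_mtx)
qed

end

section \<open>Nonvanishing of P, traces and nilpotency\<close>

lemma poly_eqI_on_reals:
  fixes p q :: "'f::real_normed_field poly"
  assumes "\<And>t::real. poly p (of_real t) = poly q (of_real t)"
  shows "p = q"
proof (rule ccontr)
  assume "p \<noteq> q"
  then have "finite {s. poly (p - q) s = 0}" by (intro poly_roots_finite) simp
  moreover have "range (of_real :: real \<Rightarrow> 'f) \<subseteq> {s. poly (p - q) s = 0}" using assms by auto
  ultimately have "finite (range (of_real :: real \<Rightarrow> 'f))" by (rule rev_finite_subset)
  then show False
    using finite_imageD[OF _ inj_of_real] infinite_UNIV_char_0[where 'a = real] by blast
qed

lemma has_vector_derivative_poly:
  fixes p :: "'f::real_normed_field poly"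
  shows "((\<lambda>s. poly p (of_real s)) has_vector_derivative poly (pderiv p) (of_real t)) (at t)"
  by (rule has_vector_derivative_real_field) (rule poly_DERIV)

context finite_dim_space
begin

lemma lin_funpow: "lin T \<Longrightarrow> lin (T ^^ k)"
  unfolding lin_iff by (induction k) auto

text \<open>
  The ranges of the powers of \<open>T\<close> decrease, so two consecutive ones agree by dimension, and then
  \<open>T\<^sup>k (- v)\<close> is the value of \<open>T\<^sup>k\<^sup>+\<^sup>1\<close> at some \<open>p\<close>. In terms of the affine field
  \<open>y \<mapsto> T y + v\<close>: it has a point \<open>p\<close> whose integral curve
  \<open>p + \<Sum>m. t\<^sup>m\<^sup>+\<^sup>1 / (m+1)! * T\<^sup>m (T p + v)\<close> breaks off and is therefore polynomial in the time.
  This point lies in the given space itself, even if \<open>T\<close> has eigenvalues outside the scalar field.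
\<close>

lemma affine_field_nilpotent_at_some_point:
  assumes T: "lin T"
  shows "\<exists>k p. (T ^^ k) (T p + v) = 0"
proof -
  interpret fd: finite_dimensional_vector_space scale "set basis"
    by unfold_locales (use basis in auto)
  have sub: "subspace (range (T ^^ k))" for k
  proof (rule subspaceI)
    have add: "(T ^^ k) x + (T ^^ k) y = (T ^^ k) (x + y)"
      and scl: "scale c ((T ^^ k) x) = (T ^^ k) (scale c x)" for x y c
      using lin_funpow[OF T, of k] unfolding lin_iff by simp_all
    show "0 \<in> range (T ^^ k)" using scl[of 0 0] by (metis scale_zero_left rangeI)
    show "x + y \<in> range (T ^^ k)" if "x \<in> range (T ^^ k)" "y \<in> range (T ^^ k)" for x y
      using that add by auto
    show "scale c x \<in> range (T ^^ k)" if "x \<in> range (T ^^ k)" for c x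
      using that scl by auto
  qed
  obtain k where k: "\<And>j. dim (range (T ^^ k)) \<le> dim (range (T ^^ j))"
    using ex_has_least_nat[of "\<lambda>_. True" 0 "\<lambda>k. dim (range (T ^^ k))"] by auto
  have "range (T ^^ Suc k) = range (T ^^ k)"
  proof (rule fd.subspace_dim_equal[OF sub sub])
    show "range (T ^^ Suc k) \<subseteq> range (T ^^ k)"
      unfolding funpow_Suc_right by auto
  qed (rule k)
  then have "(T ^^ k) (- v) \<in> range (T ^^ Suc k)" by (simp only: rangeI)
  then obtain p where "(T ^^ k) (- v) = (T ^^ Suc k) p" by (rule imageE)
  then have "(T ^^ k) (T p) = (T ^^ k) (- v)"
    by (simp only: funpow_Suc_right o_apply)
  moreover have "(T ^^ k) (T p + v + - v) = (T ^^ k) (T p + v) + (T ^^ k) (- v)"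
    using lin_funpow[OF T, of k] unfolding lin_iff by blast
  ultimately have "(T ^^ k) (T p + v) = 0" by simp
  then show ?thesis by blast
qed

end

context left_symmetric_algebra
begin

lemma mul_sum_right: "x \<star> sum f S = (\<Sum>s\<in>S. x \<star> f s)"
proof (induction S rule: infinite_finite_induct)
  have "x \<star> 0 = 0" using mul_scale_right[of x 0 0] by simp
  then show "x \<star> sum f {} = (\<Sum>s\<in>{}. x \<star> f s)"
    and "\<And>A. infinite A \<Longrightarrow> x \<star> sum f A = (\<Sum>s\<in>A. x \<star> f s)" by simp_all
qed (simp add: mul_add_right)

lemma P_polynomial_on_curve:
  "\<exists>Q. \<forall>s. P (\<Sum>m<M. s ^ m \<cdot> u m) = poly Q s"
proof -
  define B where "B = mat rank rank (\<lambda>(i, j). [:crd i (basis ! j):] +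
    (\<Sum>m<M. monom (crd i (basis ! j \<star> u m)) m))"
  have "P (\<Sum>m<M. s ^ m \<cdot> u m) = poly (det B) s" for s
    unfolding P_def op_det_mtx
    by (rule poly_det_cong[symmetric, of _ rank])
      (auto simp: B_def R_def mul_sum_right mul_scale_right poly_sum poly_monom mult.commute)
  then show ?thesis by blast
qed

text \<open>
  Along the polynomial integral curve of \<open>F x\<close> the function \<open>P\<close> is a polynomial \<open>Q\<close> in the time,
  while \<open>has_vector_derivative_P\<close> gives \<open>Q' = tr R(x) * Q\<close>. A nonzero polynomial has this property
  only if the factor is zero.
\<close>

lemma trace_zero_if_P_nonzero:
  assumes P: "\<And>y. P y \<noteq> 0"
  shows "op_trace (R x) = 0"
proof -
  define T where "T = (\<lambda>y. x \<star> y)"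
  have T: "lin T" unfolding T_def by (rule mul_linear_right)
  obtain k p where k: "(T ^^ k) (T p + x) = 0"
    using affine_field_nilpotent_at_some_point[OF T] by blast
  \<comment> \<open>The Taylor coefficients at time 0 of the integral curve through \<open>p\<close>.\<close>
  define y where "y m = (case m of 0 \<Rightarrow> p | Suc m \<Rightarrow> (T ^^ m) (T p + x))" for m
  have y_Suc: "y (Suc m) = T (y m) + (if m = 0 then x else 0)" for m
    by (cases m) (auto simp: y_def)
  have y_end: "y (Suc k) = 0" using k by (simp add: y_def)
  define \<gamma> where "\<gamma> s = (\<Sum>m<Suc k. s ^ m \<cdot> (inverse (fact m) \<cdot> y m))" for s :: 'f
  have vel: "has_velocity (\<lambda>s. \<gamma> (of_real s)) (F x (\<gamma> (of_real t))) t" for t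
    unfolding has_velocity_def
  proof (intro allI impI)
    fix l :: "'v \<Rightarrow> 'f" assume l: "Vector_Spaces.linear scale (*) l"
    have l_sum: "l (\<Sum>m\<in>S. c m \<cdot> f m) = (\<Sum>m\<in>S. c m * l (f m))" for c f and S :: "nat set"
    proof (induction S rule: infinite_finite_induct)
      have "l 0 = 0" using l unfolding functional_iff by (metis mult_zero_left scale_zero_left)
      then show "l (\<Sum>m\<in>{}. c m \<cdot> f m) = (\<Sum>m\<in>{}. c m * l (f m))"
        and "\<And>A. infinite A \<Longrightarrow> l (\<Sum>m\<in>A. c m \<cdot> f m) = (\<Sum>m\<in>A. c m * l (f m))" by simp_all
    qed (use l in \<open>simp add: functional_iff\<close>)
    define q where "q = (\<Sum>m<Suc k. monom (inverse (fact m) * l (y m)) m)"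
    have l_\<gamma>: "l (\<gamma> s) = poly q s" for s
      using l unfolding \<gamma>_def l_sum q_def functional_iff by (simp add: poly_sum poly_monom mult.commute)
    have pderiv_q: "pderiv q = (\<Sum>m<Suc k. monom (inverse (fact m) * l (y (Suc m))) m)"
    proof -
      have "pderiv q = (\<Sum>m<k. pderiv (monom (inverse (fact (Suc m)) * l (y (Suc m))) (Suc m)))"
        unfolding q_def sum.lessThan_Suc_shift
        by (simp add: pderiv_add higher_pderiv_sum pderiv_sum monom_0 pderiv_pCons del: fact_Suc)
      also have "\<dots> = (\<Sum>m<k. monom (inverse (fact m) * l (y (Suc m))) m)"
        by (intro sum.cong refl) (simp add: pderiv_monom field_simps del: of_nat_Suc)
      also have "\<dots> = (\<Sum>m<Suc k. monom (inverse (fact m) * l (y (Suc m))) m)"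
        using l unfolding functional_iff by (simp add: y_end) (metis mult_zero_left scale_zero_left)
      finally show ?thesis .
    qed
    have "poly (pderiv q) s = l (F x (\<gamma> s))" for s
    proof -
      have "F x (\<gamma> s) = (\<Sum>m<Suc k. (s ^ m * inverse (fact m)) \<cdot> T (y m)) + x"
        unfolding F_def \<gamma>_def by (simp add: mul_sum_right mul_add_right mul_scale_right T_def)
      also have "\<dots> = (\<Sum>m<Suc k. (s ^ m * inverse (fact m)) \<cdot> y (Suc m))"
        unfolding sum.lessThan_Suc_shift y_Suc by (simp add: algebra_simps)
      finally have "l (F x (\<gamma> s)) = (\<Sum>m<Suc k. (s ^ m * inverse (fact m)) * l (y (Suc m)))"
        by (simp only: l_sum)
      then show ?thesis
        unfolding pderiv_q by (simp add: poly_sum poly_monom algebra_simps)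
    qed
    then show "((\<lambda>s. l (\<gamma> (of_real s))) has_vector_derivative l (F x (\<gamma> (of_real t)))) (at t)"
      using has_vector_derivative_poly[of q t] by (simp add: l_\<gamma>)
  qed
  obtain Q where Q: "\<And>s. P (\<gamma> s) = poly Q s"
    unfolding \<gamma>_def using P_polynomial_on_curve[where M = "Suc k" and u = "\<lambda>m. inverse (fact m) \<cdot> y m"] by blast
  have ode: "pderiv Q = Polynomial.smult (op_trace (R x)) Q"
  proof (rule poly_eqI_on_reals)
    fix t :: real
    show "poly (pderiv Q) (of_real t) = poly (Polynomial.smult (op_trace (R x)) Q) (of_real t)"
      using vector_derivative_unique_at[OF has_vector_derivative_poly[of Q t]
          has_vector_derivative_P[OF vel[of t], unfolded Q]]
      by (simp add: mult.commute)
  qed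
  have "Q \<noteq> 0" using P[of "\<gamma> 0"] Q[of 0] by auto
  show ?thesis
  proof (rule ccontr)
    assume "op_trace (R x) \<noteq> 0"
    with ode \<open>Q \<noteq> 0\<close> have "degree Q - 1 = degree Q" using degree_pderiv[of Q] by simp
    then have "pderiv Q = 0" by (simp add: pderiv_eq_0_iff)
    with ode \<open>Q \<noteq> 0\<close> \<open>op_trace (R x) \<noteq> 0\<close> show False by simp
  qed
qed

text \<open>
  Where \<open>P (s y) \<noteq> 0\<close> the fields \<open>F x\<close> span all directions at \<open>s y\<close>, in particular the direction \<open>y\<close>
  of the ray, so the derivative of \<open>P\<close> along the ray vanishes there. For the polynomial
  \<open>Q(s) = P (s y)\<close> this means \<open>Q' * Q = 0\<close>, hence \<open>Q\<close> is constant.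
\<close>

lemma P_one_if_trace_zero:
  assumes tr: "\<And>x. op_trace (R x) = 0"
  shows "P y = 1"
proof -
  have curve: "s \<cdot> y = (\<Sum>m<2. s ^ m \<cdot> (if m = 0 then 0 else y))" for s
    by (simp add: numeral_2_eq_2)
  obtain Q where Q: "\<And>s. P (s \<cdot> y) = poly Q s"
    using P_polynomial_on_curve[where M = 2 and u = "\<lambda>m. if m = 0 then 0 else y"] unfolding curve by blast
  have vel: "has_velocity (\<lambda>s. of_real s \<cdot> y) y t" for t
    unfolding has_velocity_def functional_iff
    by (auto intro!: derivative_eq_intros has_vector_derivative_of_real[where D = 1, simplified])
  have "pderiv Q * Q = 0"
  proof (rule poly_eqI_on_reals)
    fix t :: real
    show "poly (pderiv Q * Q) (of_real t) = poly 0 (of_real t :: 'f)"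
    proof (cases "P (of_real t \<cdot> y) = 0")
      case True then show ?thesis by (simp add: Q)
    next
      case False
      then obtain g where g: "\<And>v. g v + R (of_real t \<cdot> y) (g v) = v"
        unfolding P_def by (rule op_det_nonzero_inverse[OF lin_one_plus_R]) blast
      have "F (g y) (of_real t \<cdot> y) = y" using g by (simp add: F_eq)
      then have "((\<lambda>s. P (of_real s \<cdot> y)) has_vector_derivative 0) (at t)"
        using has_vector_derivative_P[of "\<lambda>s. of_real s \<cdot> y" "g y" t] vel[of t] tr by simp
      then have "poly (pderiv Q) (of_real t) = 0"
        using vector_derivative_unique_at[OF has_vector_derivative_poly[of Q t]] unfolding Q by simp
      then show ?thesis by simp
    qed
  qed
  moreover have "Q \<noteq> 0" using Q[of 0] P_zero by auto
  ultimately have "pderiv Q = 0" by simp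
  then obtain c where "Q = [:c:]" using pderiv_iszero by blast
  then show ?thesis using Q[of 0] Q[of 1] P_zero by simp
qed

text \<open>
  If \<open>det (I + s R(x)) = 1\<close> for all \<open>s\<close>, then the adjugate is a polynomial in \<open>s\<close> that inverts
  \<open>I + s R(x)\<close>. Its coefficients can only be those of the geometric series, \<open>(- R(x))\<^sup>k\<close>, and they
  vanish for large \<open>k\<close>. The vectors \<open>w k j\<close> of the proof are the columns of these coefficients.
\<close>

lemma nilpotent_if_P_one:
  assumes P: "\<And>y. P y = 1"
  shows "nilpotent_op (R x)"
proof -
  define M where "M = mat rank rank (\<lambda>(i, j). [:if i = j then 1 else 0, crd i (R x (basis ! j)):])"
  define C where "C = adj_mat M"
  have M: "M \<in> carrier_mat rank rank" by (simp add: M_def)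
  have "det M = 1"
  proof (rule poly_eqI_on_reals)
    fix t :: real
    have "poly (det M) (of_real t) = P (of_real t \<cdot> x)"
      unfolding P_def op_det_mtx
      by (rule poly_det_cong[of _ rank]) (auto simp: M_def R_def crd_basis mul_scale_right)
    then show "poly (det M) (of_real t) = poly 1 (of_real t)" by (simp add: P)
  qed
  then have C: "C \<in> carrier_mat rank rank" "M * C = 1\<^sub>m rank"
    unfolding C_def using adj_mat[OF M] by auto
  define w where "w k j = from_crd (\<lambda>i. coeff (C $$ (i, j)) k)" for k j
  have MC: "(if i = j then 1 else 0) = (\<Sum>l<rank. M $$ (i, l) * C $$ (l, j))"
    if "i < rank" "j < rank" for i j
  proof -
    have "(M * C) $$ (i, j) = (\<Sum>l<rank. M $$ (i, l) * C $$ (l, j))"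
      using that M C(1) by (simp add: scalar_prod_def lessThan_atLeast0)
    then show ?thesis unfolding C(2) using that by simp
  qed
  have w_0: "w 0 j = basis ! j" if j: "j < rank" for j
  proof (rule crd_eqI)
    fix i assume i: "i < rank"
    have "coeff (if i = j then 1 else 0) 0 = (\<Sum>l<rank. coeff (M $$ (i, l) * C $$ (l, j)) 0)"
      unfolding MC[OF i j] coeff_sum ..
    also have "\<dots> = (\<Sum>l<rank. if i = l then coeff (C $$ (l, j)) 0 else 0)"
      using i j by (intro sum.cong) (auto simp: M_def)
    finally show "crd i (w 0 j) = crd i (basis ! j)"
      using i j by (simp add: w_def crd_basis split: if_splits)
  qed
  have w_Suc: "w (Suc k) j = - R x (w k j)" if j: "j < rank" for k j
  proof (rule crd_eqI)
    fix i assume i: "i < rank"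
    have "0 = coeff (if i = j then 1 else 0 :: 'f poly) (Suc k)" by simp
    also have "\<dots> = (\<Sum>l<rank. coeff (M $$ (i, l) * C $$ (l, j)) (Suc k))"
      unfolding MC[OF i j] coeff_sum ..
    also have "\<dots> = (\<Sum>l<rank. (if i = l then coeff (C $$ (l, j)) (Suc k) else 0)
        + crd i (R x (basis ! l)) * coeff (C $$ (l, j)) k)"
      using i j by (intro sum.cong) (auto simp: M_def)
    also have "\<dots> = crd i (w (Suc k) j) + crd i (R x (w k j))"
      using i j by (simp add: sum.distrib w_def crd_lin[OF lin_R, of i x "from_crd _"])
    finally show "crd i (w (Suc k) j) = crd i (- R x (w k j))"
      by (simp add: eq_neg_iff_add_eq_0)
  qed
  have lin_pow: "lin (R x ^^ k)" for k by (rule lin_funpow[OF lin_R])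
  have w_pow: "(R x ^^ k) (basis ! j) = (-1) ^ k \<cdot> w k j" if j: "j < rank" for k j
  proof (induction k)
    case (Suc k)
    then show ?case
      using lin_R[of x] unfolding lin_iff by (simp add: w_Suc[OF j])
  qed (simp add: w_0[OF j])
  define K where "K = Suc (\<Sum>i<rank. \<Sum>j<rank. degree (C $$ (i, j)))"
  have "w K j = 0" if j: "j < rank" for j
  proof (rule crd_eqI)
    fix i assume i: "i < rank"
    have "degree (C $$ (i, j)) \<le> (\<Sum>j<rank. degree (C $$ (i, j)))"
      using j by (intro member_le_sum) auto
    also have "\<dots> \<le> (\<Sum>i<rank. \<Sum>j<rank. degree (C $$ (i, j)))"
      using i by (intro member_le_sum[of i]) auto
    finally have "coeff (C $$ (i, j)) K = 0" by (intro coeff_eq_0) (simp add: K_def)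
    then show "crd i (w K j) = crd i 0" using i by (simp add: w_def)
  qed
  then have "(R x ^^ K) (basis ! j) = 0" if "j < rank" for j using w_pow[OF that] that by simp
  then have "(R x ^^ K) v = 0" for v
    by (intro crd_eqI) (simp add: crd_lin[OF lin_pow])
  then show ?thesis unfolding nilpotent_op_def by blast
qed

lemma P_nonzero_if_nilpotent:
  assumes "nilpotent_op (R x)"
  shows "P x \<noteq> 0"
  unfolding P_def
proof (rule op_det_nonzero_injective[OF lin_one_plus_R])
  fix v assume "v + R x v = 0"
  then have Rv: "R x v = - v" by (simp add: eq_neg_iff_add_eq_0 add.commute)
  have neg: "R x (- z) = - R x z" for z
    using lin_R[of x] unfolding lin_iff by (metis scale_minus_left scale_one)
  obtain k where "(R x ^^ k) v = 0" using assms unfolding nilpotent_op_def by blast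
  moreover have "(R x ^^ k) v = v \<or> (R x ^^ k) v = - v" for k
    by (induction k) (auto simp: Rv neg)
  ultimately show "v = 0" by (metis neg_equal_0_iff_equal)
qed

end

section \<open>Uniqueness of integral curves and the necessity of the condition on P\<close>

lemma gronwall_zero:
  fixes h :: "real \<Rightarrow> real"
  assumes h: "\<And>t. (h has_real_derivative h' t) (at t)"
    and bound: "\<And>t. \<bar>h' t\<bar> \<le> C * h t" and nonneg: "\<And>t. 0 \<le> h t" and zero: "h t0 = 0"
  shows "h t = 0"
proof -
  have "h t \<le> 0"
  proof (cases "t0 \<le> t")
    case True
    have "h t * exp (- C * t) \<le> h t0 * exp (- C * t0)"
    proof (rule DERIV_nonpos_imp_nonincreasing[OF True])
      fix s
      have "((\<lambda>s. h s * exp (- C * s)) has_real_derivative (h' s - C * h s) * exp (- C * s)) (at s)"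
        by (auto intro!: derivative_eq_intros h simp: algebra_simps)
      moreover have "(h' s - C * h s) * exp (- C * s) \<le> 0"
        using bound[of s] by (intro mult_nonpos_nonneg) auto
      ultimately show "\<exists>y. ((\<lambda>s. h s * exp (- C * s)) has_real_derivative y) (at s) \<and> y \<le> 0"
        by blast
    qed
    then show ?thesis by (simp add: zero mult_le_0_iff)
  next
    case False
    then have "t \<le> t0" by simp
    have "h t * exp (C * t) \<le> h t0 * exp (C * t0)"
    proof (rule DERIV_nonneg_imp_nondecreasing[OF \<open>t \<le> t0\<close>])
      fix s
      have "((\<lambda>s. h s * exp (C * s)) has_real_derivative (h' s + C * h s) * exp (C * s)) (at s)"
        by (auto intro!: derivative_eq_intros h simp: algebra_simps)
      moreover have "0 \<le> (h' s + C * h s) * exp (C * s)"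
        using bound[of s] by (intro mult_nonneg_nonneg) auto
      ultimately show "\<exists>y. ((\<lambda>s. h s * exp (C * s)) has_real_derivative y) (at s) \<and> 0 \<le> y"
        by blast
    qed
    then show ?thesis by (simp add: zero mult_le_0_iff)
  qed
  with nonneg[of t] show ?thesis by simp
qed

lemma scalar_linear_ode:
  fixes q :: "real \<Rightarrow> 'f::{real_normed_field,banach}"
  assumes q: "\<And>t. (q has_vector_derivative q t * c) (at t)"
  shows "q t = q 0 * exp (of_real t * c)"
proof -
  define r where "r s = q s * exp (of_real s * (- c))" for s
  have "((\<lambda>s. exp (of_real s * (- c))) has_vector_derivative exp (of_real s * (- c)) * (- c)) (at s)" for s
    by (rule has_vector_derivative_real_field) (auto intro!: derivative_eq_intros)
  then have "(r has_vector_derivative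
      (q s * (exp (of_real s * (- c)) * (- c)) + q s * c * exp (of_real s * (- c)))) (at s)" for s
    unfolding r_def by (intro has_vector_derivative_mult q)
  then have "(r has_vector_derivative 0) (at s within UNIV)" for s by (simp add: algebra_simps)
  then obtain d where "\<And>s. r s = d"
    using has_vector_derivative_zero_constant[of UNIV r] by auto
  then have "r t = r 0" by simp
  then have "q t * exp (- (of_real t * c)) * exp (of_real t * c) = q 0 * exp (of_real t * c)"
    by (simp add: r_def)
  moreover have "exp (- (of_real t * c)) * exp (of_real t * c) = 1"
    by (simp add: exp_minus_inverse mult.commute)
  ultimately show ?thesis by (simp add: mult.assoc)
qed

text \<open>
  A Banach field of scalars lets the exponential series converge coordinatewise; its real inner
  product makes the sum of the squared norms of the coordinates a differentiable function of the time.
  Both the real and the complex numbers qualify.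
\<close>

locale banach_left_symmetric_algebra = left_symmetric_algebra scale mul
  for scale :: "'f::{real_normed_field,banach,real_inner} \<Rightarrow> 'v::ab_group_add \<Rightarrow> 'v" (infixr "\<cdot>" 75)
    and mul :: "'v \<Rightarrow> 'v \<Rightarrow> 'v" (infixl "\<star>" 70)
begin

definition nrm :: "'v \<Rightarrow> real" where "nrm v = (\<Sum>i<rank. norm (crd i v))"

lemma nrm_nonneg [simp]: "0 \<le> nrm v"
  unfolding nrm_def by (simp add: sum_nonneg)

lemma norm_crd_le: "i < rank \<Longrightarrow> norm (crd i v) \<le> nrm v"
  unfolding nrm_def by (rule member_le_sum) auto

lemma nrm_eq_0_iff [simp]: "nrm v = 0 \<longleftrightarrow> v = 0"
proof
  assume "nrm v = 0"
  then have "norm (crd i v) = 0" if "i < rank" for i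
    using norm_crd_le[OF that, of v] by simp
  then show "v = 0" by (intro crd_eqI) simp
qed (simp add: nrm_def)

lemma nrm_0 [simp]: "nrm 0 = 0" by simp

lemma nrm_triangle: "nrm (v + w) \<le> nrm v + nrm w"
  unfolding nrm_def sum.distrib[symmetric] by (intro sum_mono) (simp add: norm_triangle_ineq)

lemma nrm_scale: "nrm (c \<cdot> v) = norm c * nrm v"
  unfolding nrm_def by (simp add: norm_mult sum_distrib_left)

lemma nrm_minus_commute: "nrm (v - w) = nrm (w - v)"
  unfolding nrm_def by (simp add: norm_minus_commute)

lemma nrm_triangle_diff: "nrm (v - w) \<le> nrm v + nrm w"
  unfolding nrm_def sum.distrib[symmetric] by (intro sum_mono) (simp add: norm_triangle_ineq4)

lemma lin_diff: "lin T \<Longrightarrow> T (v - w) = T v - T w"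
proof -
  assume "lin T"
  then have "T (v - w) + T w = T (v - w + w)" unfolding lin_iff by metis
  then show ?thesis by (simp add: eq_diff_eq)
qed

lemma nrm_lin_le:
  assumes T: "lin T"
  shows "nrm (T v) \<le> (\<Sum>j<rank. nrm (T (basis ! j))) * nrm v"
proof -
  have "nrm (T v) \<le> (\<Sum>i<rank. \<Sum>j<rank. norm (crd i (T (basis ! j))) * norm (crd j v))"
    unfolding nrm_def crd_lin[OF T, of _ v]
    by (intro sum_mono) (simp add: norm_mult[symmetric] sum_norm_le)
  also have "\<dots> = (\<Sum>j<rank. nrm (T (basis ! j)) * norm (crd j v))"
    by (subst sum.swap) (simp add: nrm_def sum_distrib_right)
  also have "\<dots> \<le> (\<Sum>j<rank. nrm (T (basis ! j)) * nrm v)"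
    by (intro sum_mono mult_left_mono norm_crd_le) auto
  finally show ?thesis by (simp add: sum_distrib_right)
qed

lemma lin_bounded:
  assumes "lin T"
  obtains K where "0 \<le> K" "\<And>v. nrm (T v) \<le> K * nrm v"
  using nrm_lin_le[OF assms] by (meson nrm_nonneg sum_nonneg)

lemma mul_bounded:
  obtains K where "0 \<le> K" "\<And>x y. nrm (x \<star> y) \<le> K * nrm x * nrm y"
proof
  let ?K = "\<Sum>j<rank. \<Sum>i<rank. nrm (basis ! i \<star> basis ! j)"
  show "0 \<le> ?K" by (intro sum_nonneg) auto
  fix x y
  have "nrm (x \<star> y) \<le> (\<Sum>j<rank. nrm (x \<star> basis ! j)) * nrm y"
    by (rule nrm_lin_le[OF mul_linear_right])
  also have "\<dots> \<le> (\<Sum>j<rank. (\<Sum>i<rank. nrm (basis ! i \<star> basis ! j)) * nrm x) * nrm y"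
    by (intro mult_right_mono sum_mono nrm_lin_le[OF mul_linear_left]) auto
  finally show "nrm (x \<star> y) \<le> ?K * nrm x * nrm y" by (simp add: sum_distrib_right)
qed

lemma has_velocity_iff:
  "has_velocity \<gamma> v t \<longleftrightarrow>
     (\<forall>i<rank. ((\<lambda>s. crd i (\<gamma> s)) has_vector_derivative crd i v) (at t))"
proof
  assume "has_velocity \<gamma> v t"
  then show "\<forall>i<rank. ((\<lambda>s. crd i (\<gamma> s)) has_vector_derivative crd i v) (at t)"
    unfolding has_velocity_def using crd_functional by blast
next
  assume crd: "\<forall>i<rank. ((\<lambda>s. crd i (\<gamma> s)) has_vector_derivative crd i v) (at t)"
  show "has_velocity \<gamma> v t"
    unfolding has_velocity_def
  proof (intro allI impI)
    fix l :: "'v \<Rightarrow> 'f" assume l: "Vector_Spaces.linear scale (*) l"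
    have "((\<lambda>s. \<Sum>i<rank. crd i (\<gamma> s) * l (basis ! i)) has_vector_derivative
        (\<Sum>i<rank. crd i v * l (basis ! i))) (at t)"
      by (intro has_vector_derivative_sum has_vector_derivative_mult_left) (use crd in auto)
    then show "((\<lambda>s. l (\<gamma> s)) has_vector_derivative l v) (at t)"
      by (simp add: functional_sum[OF l, symmetric])
  qed
qed

lemma has_velocity_shift:
  assumes "has_velocity \<gamma> v (t + a)"
  shows "has_velocity (\<lambda>s. \<gamma> (s + a)) v t"
  unfolding has_velocity_iff
proof (intro allI impI)
  fix i assume "i < rank"
  then have "((\<lambda>s. crd i (\<gamma> s)) has_vector_derivative crd i v) (at (t + a))"
    using assms unfolding has_velocity_iff by blast
  moreover have "((\<lambda>s. s + a) has_vector_derivative 1) (at t)"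
    by (auto intro!: derivative_eq_intros)
  ultimately show "((\<lambda>s. crd i (\<gamma> (s + a))) has_vector_derivative crd i v) (at t)"
    using vector_diff_chain_at[of "\<lambda>s. s + a" 1 t "\<lambda>s. crd i (\<gamma> s)" "crd i v"] by (simp add: o_def)
qed

lemma has_velocity_diff:
  "has_velocity \<alpha> v t \<Longrightarrow> has_velocity \<beta> w t \<Longrightarrow> has_velocity (\<lambda>s. \<alpha> s - \<beta> s) (v - w) t"
  unfolding has_velocity_iff by (auto intro: has_vector_derivative_diff)

text \<open>
  The sum \<open>h\<close> of the squared norms of the coordinates satisfies \<open>\<bar>h'\<bar> \<le> C h\<close>, so Gronwall's inequality
  propagates the zero at \<open>t0\<close> to all times.
\<close>

lemma linear_ode_zero:
  assumes T: "lin T" and \<delta>: "\<And>t. has_velocity \<delta> (T (\<delta> t)) t" and zero: "\<delta> t0 = 0"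
  shows "\<delta> t = 0"
proof -
  define h where "h s = (\<Sum>i<rank. inner (crd i (\<delta> s)) (crd i (\<delta> s)))" for s
  define h' where "h' s = (\<Sum>i<rank. inner (crd i (\<delta> s)) (crd i (T (\<delta> s)))
      + inner (crd i (T (\<delta> s))) (crd i (\<delta> s)))" for s
  define C where "C = (\<Sum>i<rank. 2 * (\<Sum>j<rank. norm (crd i (T (basis ! j)))))"
  have h_sq: "h s = (\<Sum>i<rank. (norm (crd i (\<delta> s)))\<^sup>2)" for s
    unfolding h_def by (simp add: power2_norm_eq_inner)
  have "h t = 0"
  proof (rule gronwall_zero[of h h' C t0])
    fix s
    have "((\<lambda>s. \<Sum>i<rank. inner (crd i (\<delta> s)) (crd i (\<delta> s))) has_vector_derivative h' s) (at s)"
      unfolding h'_def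
      by (intro has_vector_derivative_sum bounded_bilinear.has_vector_derivative[OF bounded_bilinear_inner])
        (use \<delta> in \<open>auto simp: has_velocity_iff\<close>)
    then show "(h has_real_derivative h' s) (at s)"
      unfolding h_def has_real_derivative_iff_has_vector_derivative .
    have le_h: "norm (crd i (\<delta> s)) \<le> sqrt (h s)" if "i < rank" for i
    proof -
      have "(norm (crd i (\<delta> s)))\<^sup>2 \<le> h s"
        unfolding h_sq by (rule member_le_sum) (use that in auto)
      then show ?thesis by (rule real_le_rsqrt)
    qed
    have h_nonneg: "0 \<le> h s" unfolding h_sq by (intro sum_nonneg) auto
    have T_le: "norm (crd i (T (\<delta> s))) \<le> (\<Sum>j<rank. norm (crd i (T (basis ! j)))) * sqrt (h s)" for i
      unfolding crd_lin[OF T, of i "\<delta> s"] sum_distrib_right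
      by (intro sum_norm_le) (auto simp: norm_mult intro!: mult_left_mono le_h)
    have term_le: "\<bar>inner (crd i (\<delta> s)) (crd i (T (\<delta> s)))\<bar>
        \<le> (\<Sum>j<rank. norm (crd i (T (basis ! j)))) * h s" if "i < rank" for i
    proof -
      have "\<bar>inner (crd i (\<delta> s)) (crd i (T (\<delta> s)))\<bar> \<le> norm (crd i (\<delta> s)) * norm (crd i (T (\<delta> s)))"
        by (rule Cauchy_Schwarz_ineq2)
      also have "\<dots> \<le> sqrt (h s) * ((\<Sum>j<rank. norm (crd i (T (basis ! j)))) * sqrt (h s))"
        by (intro mult_mono le_h that T_le) (auto simp: h_nonneg)
      also have "\<dots> = (\<Sum>j<rank. norm (crd i (T (basis ! j)))) * h s"
        using h_nonneg real_sqrt_mult_self[of "h s"] by (simp add: algebra_simps)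
      finally show ?thesis .
    qed
    have "\<bar>h' s\<bar> \<le> (\<Sum>i<rank. \<bar>inner (crd i (\<delta> s)) (crd i (T (\<delta> s)))
      + inner (crd i (T (\<delta> s))) (crd i (\<delta> s))\<bar>)"
      unfolding h'_def by (rule sum_abs)
    also have "\<dots> \<le> (\<Sum>i<rank. 2 * (\<Sum>j<rank. norm (crd i (T (basis ! j)))) * h s)"
      using term_le by (intro sum_mono) (auto simp: inner_commute abs_mult)
    also have "\<dots> = C * h s" by (simp add: C_def sum_distrib_right)
    finally show "\<bar>h' s\<bar> \<le> C * h s" .
    show "0 \<le> h s" by (rule h_nonneg)
    show "h t0 = 0" unfolding h_def by (simp add: zero)
  qed
  then have "(norm (crd i (\<delta> t)))\<^sup>2 = 0" if "i < rank" for i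
    using that sum_nonneg_eq_0_iff[of "{..<rank}" "\<lambda>i. (norm (crd i (\<delta> t)))\<^sup>2"] unfolding h_sq by auto
  then show ?thesis by (intro crd_eqI) simp
qed

lemma integral_curve_unique:
  assumes \<alpha>: "\<And>t. has_velocity \<alpha> (F x (\<alpha> t)) t" and \<beta>: "\<And>t. has_velocity \<beta> (F x (\<beta> t)) t"
    and "\<alpha> t0 = \<beta> t0"
  shows "\<alpha> t = \<beta> t"
proof -
  have "has_velocity (\<lambda>s. \<alpha> s - \<beta> s) (x \<star> (\<alpha> t - \<beta> t)) t" for t
    using has_velocity_diff[OF \<alpha> \<beta>, of t] by (simp add: F_def lin_diff[OF mul_linear_right])
  then have "\<alpha> t - \<beta> t = 0"
    by (rule linear_ode_zero[OF mul_linear_right, of "\<lambda>s. \<alpha> s - \<beta> s" x t0]) (simp add: assms)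
  then show ?thesis by simp
qed

text \<open>
  The group \<open>G\<close> is generated by arbitrary families of solution curves and by \<open>inv_into\<close>, which is an
  inverse only for bijections. That a flow consists of bijections follows from uniqueness of integral
  curves, since \<open>\<phi> t\<close> and \<open>\<phi> (- t)\<close> undo each other.
\<close>

lemma flow_bij:
  assumes \<phi>: "is_flow (F x) \<phi>"
  shows "bij (\<phi> t)"
proof -
  have \<phi>_0: "\<phi> 0 p = p" and vel: "has_velocity (\<lambda>s. \<phi> s p) (F x (\<phi> t p)) t" for p t
    using \<phi> unfolding is_flow_def by auto
  have "inj (\<phi> t)"
  proof (rule injI)
    fix p q assume "\<phi> t p = \<phi> t q"
    then have "\<phi> 0 p = \<phi> 0 q" by (rule integral_curve_unique[OF vel vel])
    then show "p = q" by (simp add: \<phi>_0)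
  qed
  moreover have "\<phi> t (\<phi> (- t) p) = p" for p
  proof -
    have "\<phi> t (\<phi> (- t) p) = \<phi> (t + - t) p"
      by (rule integral_curve_unique[of "\<lambda>s. \<phi> s (\<phi> (- t) p)" x "\<lambda>s. \<phi> (s + - t) p" 0 t])
        (use vel has_velocity_shift[OF vel] in \<open>simp_all only: \<phi>_0 add_0_left\<close>)
    then show ?thesis by (simp add: \<phi>_0)
  qed
  then have "surj (\<phi> t)" by (metis surjI)
  ultimately show ?thesis by (simp add: bij_def)
qed

lemma G_bij_P:
  assumes "g \<in> G"
  shows "bij g \<and> (\<forall>y. P (g y) = 0 \<longleftrightarrow> P y = 0)"
  using assms
proof induction
  case (flow x \<phi> t)
  then have \<phi>_0: "\<phi> 0 y = y" and vel: "has_velocity (\<lambda>s. \<phi> s y) (F x (\<phi> t y)) t" for y t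
    unfolding is_flow_def by auto
  have "P (\<phi> t y) = P (\<phi> 0 y) * exp (of_real t * op_trace (R x))" for y
    by (rule scalar_linear_ode) (rule has_vector_derivative_P[OF vel])
  then show ?case using flow_bij[OF flow] by (simp add: \<phi>_0)
next
  case (comp g h)
  then show ?case using bij_comp[of h g] by (simp add: o_def)
next
  case (inverse g)
  then have "g (inv_into UNIV g y) = y" for y by (simp add: bij_is_surj surj_f_inv_f)
  with inverse show ?case by (metis bij_imp_bij_inv)
qed (simp add: bij_id[unfolded id_def])

text \<open>
  The orbit of \<open>0\<close> stays in the set where \<open>P \<noteq> 0\<close>, because \<open>P 0 = 1\<close>.
\<close>

lemma P_nonzero_if_complete:
  assumes complete
  shows "P y \<noteq> 0"
proof -
  obtain g where "g \<in> G" "g 0 = y" using assms unfolding complete_def by blast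
  then show ?thesis using G_bij_P[of g] P_zero by auto
qed

end

section \<open>Exponential series and the flows of the affine fields\<close>

context banach_left_symmetric_algebra
begin

definition exp_bounded :: "(nat \<Rightarrow> 'v) \<Rightarrow> bool" where
  "exp_bounded a \<longleftrightarrow> (\<exists>C M. \<forall>k. nrm (a k) \<le> C * M ^ k)"

text \<open>
  The vector with the expansion \<open>\<Sum>k. t\<^sup>k / k! * a k\<close>, formed coordinatewise because the space carries
  no topology.
\<close>

definition expsum :: "(nat \<Rightarrow> 'v) \<Rightarrow> real \<Rightarrow> 'v" where
  "expsum a t = from_crd (\<lambda>i. \<Sum>k. crd i (a k) / fact k * of_real t ^ k)"

lemma exp_boundedI: "(\<And>k. nrm (a k) \<le> C * M ^ k) \<Longrightarrow> exp_bounded a"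
  unfolding exp_bounded_def by blast

lemma exp_term_le:
  assumes "\<And>k. nrm (a k) \<le> C * M ^ k" "i < rank"
  shows "norm (crd i (a k) / fact k * z ^ k) \<le> C * (inverse (fact k) * (M * norm z) ^ k)"
proof -
  have "norm (crd i (a k) / fact k * z ^ k) = norm (crd i (a k)) * (inverse (fact k) * norm z ^ k)"
    by (simp add: norm_mult norm_inverse norm_power divide_inverse)
  also have "\<dots> \<le> (C * M ^ k) * (inverse (fact k) * norm z ^ k)"
    using norm_crd_le[OF assms(2), of "a k"] assms(1)[of k] by (intro mult_right_mono) auto
  finally show ?thesis by (simp add: power_mult_distrib mult.commute mult.left_commute)
qed

lemma summable_exp_terms:
  assumes "exp_bounded a" "i < rank"
  shows "summable (\<lambda>k. crd i (a k) / fact k * z ^ k)"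
proof -
  obtain C M where "\<And>k. nrm (a k) \<le> C * M ^ k" using assms(1) unfolding exp_bounded_def by blast
  then show ?thesis
    by (intro summable_comparison_test'[where N = 0, OF summable_mult[OF summable_exp]])
      (rule exp_term_le[OF _ assms(2)])
qed

lemma expsum_sums:
  assumes "exp_bounded a" "i < rank"
  shows "(\<lambda>k. crd i (a k) / fact k * of_real t ^ k) sums crd i (expsum a t)"
  using summable_sums[OF summable_exp_terms[OF assms, of "of_real t"]] assms(2)
  by (simp add: expsum_def)

lemma expsum_0: "expsum a 0 = a 0"
  by (rule crd_eqI) (simp add: expsum_def powser_zero[of "\<lambda>k. crd _ (a k) / fact k", simplified])

lemma has_velocity_expsum:
  assumes a: "exp_bounded a"
  shows "has_velocity (expsum a) (expsum (\<lambda>k. a (Suc k)) t) t"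
  unfolding has_velocity_iff
proof (intro allI impI)
  fix i assume i: "i < rank"
  have "((\<lambda>z. \<Sum>k. crd i (a k) / fact k * z ^ k) has_field_derivative
      (\<Sum>k. diffs (\<lambda>k. crd i (a k) / fact k) k * of_real t ^ k)) (at (of_real t))"
    by (rule termdiffs_strong_converges_everywhere) (rule summable_exp_terms[OF a i])
  moreover have "diffs (\<lambda>k. crd i (a k) / fact k) = (\<lambda>k. crd i (a (Suc k)) / fact k)"
    by (simp add: diffs_def fun_eq_iff field_simps del: of_nat_Suc)
  ultimately have "((\<lambda>s. \<Sum>k. crd i (a k) / fact k * of_real s ^ k) has_vector_derivative
      (\<Sum>k. crd i (a (Suc k)) / fact k * of_real t ^ k)) (at t)"
    by (intro has_vector_derivative_real_field) simp
  then show "((\<lambda>s. crd i (expsum a s)) has_vector_derivative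
      crd i (expsum (\<lambda>k. a (Suc k)) t)) (at t)"
    using i by (simp add: expsum_def)
qed

lemma expsum_add:
  assumes "exp_bounded a" "exp_bounded b"
  shows "exp_bounded (\<lambda>k. a k + b k)" "expsum (\<lambda>k. a k + b k) t = expsum a t + expsum b t"
proof -
  obtain C M where a: "\<And>k. nrm (a k) \<le> C * M ^ k" using assms(1) unfolding exp_bounded_def by blast
  obtain D N where b: "\<And>k. nrm (b k) \<le> D * N ^ k" using assms(2) unfolding exp_bounded_def by blast
  show ab: "exp_bounded (\<lambda>k. a k + b k)"
  proof (rule exp_boundedI)
    fix k
    have "nrm (a k + b k) \<le> C * M ^ k + D * N ^ k"
      using nrm_triangle[of "a k" "b k"] a[of k] b[of k] by linarith
    also have "\<dots> \<le> \<bar>C * M ^ k\<bar> + \<bar>D * N ^ k\<bar>" by linarith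
    also have "\<dots> = \<bar>C\<bar> * \<bar>M\<bar> ^ k + \<bar>D\<bar> * \<bar>N\<bar> ^ k" by (simp add: abs_mult power_abs)
    also have "\<dots> \<le> \<bar>C\<bar> * (\<bar>M\<bar> + \<bar>N\<bar>) ^ k + \<bar>D\<bar> * (\<bar>M\<bar> + \<bar>N\<bar>) ^ k"
      by (intro add_mono mult_left_mono power_mono) auto
    finally show "nrm (a k + b k) \<le> (\<bar>C\<bar> + \<bar>D\<bar>) * (\<bar>M\<bar> + \<bar>N\<bar>) ^ k" by (simp add: algebra_simps)
  qed
  show "expsum (\<lambda>k. a k + b k) t = expsum a t + expsum b t"
  proof (rule crd_eqI)
    fix i assume i: "i < rank"
    show "crd i (expsum (\<lambda>k. a k + b k) t) = crd i (expsum a t + expsum b t)"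
      using sums_add[OF expsum_sums[OF assms(1) i, of t] expsum_sums[OF assms(2) i, of t]]
        expsum_sums[OF ab i, of t]
      by (intro sums_unique2) (simp_all add: algebra_simps add_divide_distrib)
  qed
qed

lemma expsum_lin:
  assumes T: "lin T" and a: "exp_bounded a"
  shows "exp_bounded (\<lambda>k. T (a k))" "expsum (\<lambda>k. T (a k)) t = T (expsum a t)"
proof -
  obtain C M where aCM: "\<And>k. nrm (a k) \<le> C * M ^ k" using a unfolding exp_bounded_def by blast
  obtain K where K: "0 \<le> K" "\<And>v. nrm (T v) \<le> K * nrm v" using lin_bounded[OF T] by blast
  show Ta: "exp_bounded (\<lambda>k. T (a k))"
  proof (rule exp_boundedI)
    fix k
    show "nrm (T (a k)) \<le> (K * C) * M ^ k"
      using K(2)[of "a k"] mult_left_mono[OF aCM[of k] K(1)] by simp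
  qed
  show "expsum (\<lambda>k. T (a k)) t = T (expsum a t)"
  proof (rule crd_eqI)
    fix i assume i: "i < rank"
    have "(\<lambda>k. \<Sum>j<rank. crd i (T (basis ! j)) * (crd j (a k) / fact k * of_real t ^ k))
        sums (\<Sum>j<rank. crd i (T (basis ! j)) * crd j (expsum a t))"
      by (intro sums_sum sums_mult expsum_sums[OF a]) auto
    then show "crd i (expsum (\<lambda>k. T (a k)) t) = crd i (T (expsum a t))"
      using expsum_sums[OF Ta i, of t]
      by (intro sums_unique2)
        (simp_all add: crd_lin[OF T, of i "a k" for k] crd_lin[OF T, of i "expsum a t"] sum_distrib_right sum_divide_distrib mult.assoc)
  qed
qed

lemma expsum_single:
  shows "exp_bounded (\<lambda>k. if k = m then v else 0)"
    "expsum (\<lambda>k. if k = m then v else 0) t = (of_real t ^ m / fact m) \<cdot> v"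
proof -
  show b: "exp_bounded (\<lambda>k. if k = m then v else 0)"
    by (rule exp_boundedI[of _ "nrm v" 1]) (use nrm_nonneg[of v] in auto)
  show "expsum (\<lambda>k. if k = m then v else 0) t = (of_real t ^ m / fact m) \<cdot> v"
  proof (rule crd_eqI)
    fix i assume i: "i < rank"
    have "(\<lambda>k. crd i (if k = m then v else 0) / fact k * of_real t ^ k)
        = (\<lambda>k. if k = m then crd i v / fact k * of_real t ^ k else 0)" by auto
    then show "crd i (expsum (\<lambda>k. if k = m then v else 0) t) = crd i ((of_real t ^ m / fact m) \<cdot> v)"
      using expsum_sums[OF b i, of t] sums_single[of m "\<lambda>k. crd i v / fact k * of_real t ^ k"]
      by (intro sums_unique2) (simp_all add: mult.commute)
  qed
qed

lemma nrm_expsum_le: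
  assumes a: "\<And>k. nrm (a k) \<le> C * M ^ k"
  shows "nrm (expsum a 1) \<le> real rank * (C * exp M)"
proof -
  have "norm (crd i (expsum a 1)) \<le> C * exp M" if i: "i < rank" for i
  proof -
    have "norm (crd i (expsum a 1)) = norm (\<Sum>k. crd i (a k) / fact k * of_real 1 ^ k)"
      using i by (simp add: expsum_def)
    also have "\<dots> \<le> (\<Sum>k. C * (inverse (fact k) * (M * norm (of_real 1 :: 'f)) ^ k))"
      by (rule norm_suminf_le[OF exp_term_le[OF a i]]) (intro summable_mult summable_exp)
    also have "\<dots> = C * exp M"
      by (subst suminf_mult[OF summable_exp]) (simp add: exp_def divide_inverse)
    finally show ?thesis .
  qed
  then have "nrm (expsum a 1) \<le> (\<Sum>i<rank. C * exp M)"
    unfolding nrm_def by (intro sum_mono) auto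
  then show ?thesis by simp
qed

text \<open>
  The Taylor coefficients at time 0 of the integral curve of \<open>F x\<close> through \<open>p\<close>: the velocity at \<open>p\<close> is
  \<open>F x p\<close>, and each further derivative applies the linear part of \<open>F x\<close>.
\<close>

definition flow_coeff :: "'v \<Rightarrow> 'v \<Rightarrow> nat \<Rightarrow> 'v" where
  "flow_coeff x p k = (case k of 0 \<Rightarrow> p | Suc m \<Rightarrow> ((\<lambda>y. x \<star> y) ^^ m) (F x p))"

lemma flow_coeff_Suc:
  "flow_coeff x p (Suc k) = x \<star> flow_coeff x p k + (if k = 0 then x else 0)"
  by (cases k) (auto simp: flow_coeff_def F_def)

lemma flow_coeff_bounded: "exp_bounded (flow_coeff x p)"
proof -
  obtain K where K: "0 \<le> K" "\<And>v. nrm (x \<star> v) \<le> K * nrm v"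
    using lin_bounded[OF mul_linear_right[of x]] by blast
  have pow: "nrm (((\<lambda>y. x \<star> y) ^^ m) v) \<le> K ^ m * nrm v" for m v
  proof (induction m)
    case (Suc m)
    then show ?case
      using K(2)[of "((\<lambda>y. x \<star> y) ^^ m) v"] mult_left_mono[OF Suc K(1)] by (simp add: mult.assoc)
  qed simp
  show ?thesis
  proof (rule exp_boundedI)
    fix k
    show "nrm (flow_coeff x p k) \<le> (nrm p + nrm (F x p)) * (K + 1) ^ k"
    proof (cases k)
      case (Suc m)
      have "nrm (flow_coeff x p k) \<le> K ^ m * nrm (F x p)"
        using pow by (simp add: flow_coeff_def Suc)
      also have "\<dots> \<le> (K + 1) ^ Suc m * (nrm p + nrm (F x p))"
      proof (intro mult_mono)
        have "K ^ m \<le> (K + 1) ^ m" using K(1) by (intro power_mono) auto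
        also have "\<dots> \<le> (K + 1) ^ Suc m" using K(1) by (intro power_increasing) auto
        finally show "K ^ m \<le> (K + 1) ^ Suc m" .
      qed (use K(1) in auto)
      finally show ?thesis by (simp add: Suc mult.commute)
    qed (simp add: flow_coeff_def)
  qed
qed

lemma is_flow_expsum: "is_flow (F x) (\<lambda>t p. expsum (flow_coeff x p) t)"
  unfolding is_flow_def
proof (intro allI conjI)
  fix p t
  show "expsum (flow_coeff x p) 0 = p" by (simp add: expsum_0 flow_coeff_def)
  have "expsum (\<lambda>k. flow_coeff x p (Suc k)) t = x \<star> expsum (flow_coeff x p) t + x"
    unfolding flow_coeff_Suc
    by (simp add: expsum_add expsum_lin[OF mul_linear_right flow_coeff_bounded] expsum_single)
  then show "has_velocity (expsum (flow_coeff x p)) (F x (expsum (flow_coeff x p) t)) t"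
    using has_velocity_expsum[OF flow_coeff_bounded, of x p t] by (simp add: F_def)
qed

end

context banach_left_symmetric_algebra
begin

section \<open>Orbits are neighbourhoods where P does not vanish\<close>

lemma closed_ball_mcomplete:
  "Metric_space {x. nrm x \<le> r} (\<lambda>x y. nrm (x - y))"
  "Metric_space.mcomplete {x. nrm x \<le> r} (\<lambda>x y. nrm (x - y))"
proof -
  show ms: "Metric_space {x. nrm x \<le> r} (\<lambda>x y. nrm (x - y))"
  proof
    show "nrm (x - z) \<le> nrm (x - y) + nrm (y - z)" for x y z
      using nrm_triangle[of "x - y" "y - z"] by simp
  qed (simp_all add: nrm_minus_commute)
  then interpret Metric_space "{x. nrm x \<le> r}" "\<lambda>x y. nrm (x - y)" .
  show mcomplete
    unfolding mcomplete_def
  proof (intro allI impI)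
    fix \<sigma> assume \<sigma>: "MCauchy \<sigma>"
    have "convergent (\<lambda>n. crd i (\<sigma> n))" if i: "i < rank" for i
    proof (rule Cauchy_convergent, rule metric_CauchyI)
      fix e :: real assume "0 < e"
      then obtain N where "\<And>n n'. N \<le> n \<Longrightarrow> N \<le> n' \<Longrightarrow> nrm (\<sigma> n - \<sigma> n') < e"
        using \<sigma> unfolding MCauchy_def by blast
      then have "dist (crd i (\<sigma> m)) (crd i (\<sigma> n)) < e" if "N \<le> m" "N \<le> n" for m n
        using norm_crd_le[OF i, of "\<sigma> m - \<sigma> n"] that by (fastforce simp: dist_norm)
      then show "\<exists>N. \<forall>m\<ge>N. \<forall>n\<ge>N. dist (crd i (\<sigma> m)) (crd i (\<sigma> n)) < e" by blast
    qed
    then have lim: "(\<lambda>n. crd i (\<sigma> n)) \<longlonglongrightarrow> lim (\<lambda>n. crd i (\<sigma> n))" if "i < rank" for i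
      using that convergent_LIMSEQ_iff by blast
    define l where "l = from_crd (\<lambda>i. lim (\<lambda>n. crd i (\<sigma> n)))"
    have "(\<lambda>n. \<Sum>i<rank. norm (crd i (\<sigma> n) - crd i l)) \<longlonglongrightarrow> (\<Sum>i<rank. norm (crd i l - crd i l))"
      by (intro tendsto_sum tendsto_norm tendsto_diff tendsto_const)
        (use lim in \<open>simp add: l_def\<close>)
    then have to_0: "(\<lambda>n. nrm (\<sigma> n - l)) \<longlonglongrightarrow> 0" by (simp add: nrm_def)
    have \<sigma>_le: "nrm (\<sigma> n) \<le> r" for n using \<sigma> unfolding MCauchy_def by blast
    have "nrm l \<le> r"
    proof (rule LIMSEQ_le_const[of "\<lambda>n. r + nrm (\<sigma> n - l)"])
      show "(\<lambda>n. r + nrm (\<sigma> n - l)) \<longlonglongrightarrow> r" using tendsto_add[OF tendsto_const to_0] by simp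
      have "nrm l \<le> r + nrm (\<sigma> n - l)" for n
        using nrm_triangle_diff[of "\<sigma> n" "\<sigma> n - l"] \<sigma>_le[of n] by simp
      then show "\<exists>N. \<forall>n\<ge>N. nrm l \<le> r + nrm (\<sigma> n - l)" by blast
    qed
    moreover have "\<exists>N. \<forall>n\<ge>N. nrm (\<sigma> n - l) < e" if "0 < e" for e
      using LIMSEQ_D[OF to_0 that] by simp
    ultimately have "limitin mtopology \<sigma> l sequentially"
      unfolding limit_metric_sequentially by (simp add: \<sigma>_le)
    then show "\<exists>x. limitin mtopology \<sigma> x sequentially" ..
  qed
qed

text \<open>
  The time-one flow of \<open>F x\<close> moves \<open>p\<close> to \<open>p + F x p + N x\<close>, where \<open>x \<mapsto> F x p\<close> is the linear map
  \<open>I + R(p)\<close>, invertible since \<open>P p \<noteq> 0\<close>, and \<open>N\<close> collects the terms of second and higher order. On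
  the ball of radius \<open>r\<close> the map \<open>N\<close> has a Lipschitz constant proportional to \<open>r\<close>. With the inverse
  \<open>g\<close> of \<open>I + R(p)\<close>, the equation for reaching \<open>q\<close> is the fixed point equation \<open>x = g (q - p - N x)\<close>,
  whose right-hand side is a contraction that maps a small ball into itself when \<open>q\<close> is close to \<open>p\<close>.
\<close>

lemma flow_reaches_neighbourhood:
  assumes P: "P p \<noteq> 0"
  obtains \<epsilon> where "0 < \<epsilon>"
    "\<And>q. nrm (q - p) < \<epsilon> \<Longrightarrow> \<exists>x. expsum (flow_coeff x p) 1 = q"
proof -
  obtain g where g: "lin g" and g_inv: "\<And>v. g v + R p (g v) = v"
    using P unfolding P_def by (rule op_det_nonzero_inverse[OF lin_one_plus_R]) blast
  have F_g: "F (g v) p = v" for v using g_inv by (simp add: F_eq)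
  have F_lin: "lin (\<lambda>x. F x p)" unfolding F_eq by (rule lin_one_plus_R)
  obtain K where K: "0 \<le> K" "\<And>x y. nrm (x \<star> y) \<le> K * nrm x * nrm y"
    using mul_bounded by blast
  obtain a where a: "0 \<le> a" "\<And>x. nrm (F x p) \<le> a * nrm x"
    using lin_bounded[OF F_lin] by blast
  obtain b where b: "0 \<le> b" "\<And>v. nrm (g v) \<le> b * nrm v"
    using lin_bounded[OF g] by blast
  \<comment> \<open>The coefficient of order \<open>m + 1\<close> of the flow; its degree in \<open>x\<close> is also \<open>m + 1\<close>, so \<open>N\<close> starts
    with quadratic terms.\<close>
  define u where "u x m = ((\<lambda>y. x \<star> y) ^^ m) (F x p)" for x m
  define rest where "rest x k = (if k < 2 then 0 else flow_coeff x p k)" for x k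
  define N where "N x = expsum (rest x) 1" for x
  have flow_split: "expsum (flow_coeff x p) 1 = p + F x p + N x"
    and rest_bounded: "exp_bounded (rest x)" for x
  proof -
    have rest: "rest x = (\<lambda>k. flow_coeff x p k + ((if k = 0 then - p else 0) + (if k = 1 then - F x p else 0)))"
      by (auto simp: fun_eq_iff rest_def flow_coeff_def less_2_cases_iff)
    show "exp_bounded (rest x)"
      unfolding rest by (intro expsum_add flow_coeff_bounded expsum_single)
    have "N x = expsum (flow_coeff x p) 1 + (- p + - F x p)"
      unfolding N_def rest
      by (simp add: expsum_add flow_coeff_bounded expsum_single)
    then show "expsum (flow_coeff x p) 1 = p + F x p + N x" by simp
  qed
  have u_lip: "nrm (u x m - u x' m) \<le> (real m + 1) * (K * r) ^ m * (a * nrm (x - x'))"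
    if x: "nrm x \<le> r" and x': "nrm x' \<le> r" and r: "0 \<le> r" for x x' r m
  proof -
    have u_le: "nrm (u z m) \<le> (K * r) ^ m * (a * r)" if z: "nrm z \<le> r" for z m
    proof (induction m)
      case 0
      then show ?case using a(2)[of z] mult_left_mono[OF z a(1)] by (simp add: u_def)
    next
      case (Suc m)
      have "nrm (u z (Suc m)) \<le> K * nrm z * nrm (u z m)" using K(2) by (simp add: u_def)
      also have "\<dots> \<le> (K * r) * ((K * r) ^ m * (a * r))"
        using z K(1) r Suc by (intro mult_mono) auto
      finally show ?case by (simp add: mult.assoc)
    qed
    show "nrm (u x m - u x' m) \<le> (real m + 1) * (K * r) ^ m * (a * nrm (x - x'))"
    proof (induction m)
      case 0
      then show ?case using a(2)[of "x - x'"] by (simp add: u_def lin_diff[OF F_lin])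
    next
      case (Suc m)
      have "u x (Suc m) - u x' (Suc m) = x \<star> (u x m - u x' m) + (x - x') \<star> u x' m"
        by (simp add: u_def lin_diff[OF mul_linear_right] lin_diff[OF mul_linear_left])
      then have "nrm (u x (Suc m) - u x' (Suc m))
          \<le> nrm (x \<star> (u x m - u x' m)) + nrm ((x - x') \<star> u x' m)"
        using nrm_triangle by simp
      also have "\<dots> \<le> K * nrm x * nrm (u x m - u x' m) + K * nrm (x - x') * nrm (u x' m)"
        by (intro add_mono K(2))
      also have "\<dots> \<le> (K * r) * ((real m + 1) * (K * r) ^ m * (a * nrm (x - x')))
          + K * nrm (x - x') * ((K * r) ^ m * (a * r))"
        using x x' K(1) r Suc u_le[OF x', of m] by (intro add_mono mult_mono) auto
      also have "\<dots> = (real (Suc m) + 1) * (K * r) ^ Suc m * (a * nrm (x - x'))"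
        by (simp add: algebra_simps)
      finally show ?case .
    qed
  qed
  define \<Lambda> where "\<Lambda> = real rank * (a * K * exp 2)"
  have N_lip: "nrm (N x - N x') \<le> \<Lambda> * r * nrm (x - x')"
    if x: "nrm x \<le> r" and x': "nrm x' \<le> r" and r: "0 \<le> r" "K * r \<le> 1" for x x' r
  proof -
    have minus: "lin (\<lambda>v. - v)" unfolding lin_iff by simp
    have "N x - N x' = N x + - N x'" by simp
    also have "\<dots> = expsum (\<lambda>k. rest x k + - rest x' k) 1"
      unfolding N_def by (simp only: expsum_add expsum_lin[OF minus rest_bounded] rest_bounded)
    finally have "N x - N x' = expsum (\<lambda>k. rest x k + - rest x' k) 1" .
    moreover have "nrm (expsum (\<lambda>k. rest x k + - rest x' k) 1)
        \<le> real rank * ((a * K * r * nrm (x - x')) * exp 2)"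
    proof (rule nrm_expsum_le)
      fix k
      show "nrm (rest x k + - rest x' k) \<le> (a * K * r * nrm (x - x')) * 2 ^ k"
      proof (cases "k < 2")
        case True
        then show ?thesis using a(1) K(1) r by (simp add: rest_def)
      next
        case False
        then obtain m where k: "k = Suc m" and m: "1 \<le> m" by (cases k) auto
        have "nrm (rest x k + - rest x' k) = nrm (u x m - u x' m)"
          using False by (simp add: rest_def u_def flow_coeff_def k)
        also have "\<dots> \<le> (real m + 1) * (K * r) ^ m * (a * nrm (x - x'))"
          by (rule u_lip[OF x x' r(1)])
        also have "\<dots> \<le> 2 ^ k * (K * r) * (a * nrm (x - x'))"
        proof (intro mult_right_mono mult_mono)
          \<comment> \<open>Trading the factor \<open>m + 1\<close> for a power of 2 keeps the bound geometric, as
            \<open>nrm_expsum_le\<close> requires; one factor \<open>K * r\<close> survives because \<open>m \<ge> 1\<close>.\<close>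
          have "real k \<le> 2 ^ k" using of_nat_less_two_power[of k, where 'a = real] by simp
          then show "real m + 1 \<le> 2 ^ k" by (simp add: k)
          have "(K * r) ^ m \<le> (K * r) ^ 1"
            by (rule power_decreasing[OF m]) (use K(1) r in auto)
          then show "(K * r) ^ m \<le> K * r" by simp
        qed (use K(1) r a(1) in auto)
        finally show ?thesis by (simp add: mult_ac)
      qed
    qed
    ultimately show ?thesis by (simp add: \<Lambda>_def mult_ac)
  qed
  have N_0: "N 0 = 0"
  proof -
    have "u 0 m = 0" for m
      by (induction m) (use K(2)[of 0] a(2)[of 0] nrm_nonneg in \<open>auto simp: u_def order_antisym_conv\<close>)
    then have "rest 0 = (\<lambda>k. if k = 0 then 0 else 0)"
      unfolding fun_eq_iff rest_def flow_coeff_def u_def by (auto split: nat.split)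
    then show ?thesis unfolding N_def by (simp only: expsum_single) simp
  qed
  have \<Lambda>: "0 \<le> \<Lambda>" using a(1) K(1) by (simp add: \<Lambda>_def)
  \<comment> \<open>The radius \<open>r = 1 / D\<close> makes \<open>K * r \<le> 1\<close> and the Lipschitz constant of \<open>g \<circ> N\<close> at most 1/2;
    \<open>\<epsilon>\<close> is chosen such that the constant term of the contraction has norm at most \<open>r / 2\<close>.\<close>
  define D where "D = K + 2 * b * \<Lambda> + 1"
  define r where "r = 1 / D"
  have D: "K \<le> D" "2 * (b * \<Lambda>) \<le> D" "0 < D"
    using K(1) b(1) \<Lambda> by (simp_all add: D_def add_increasing add_increasing2 add_nonneg_pos)
  then have r: "0 < r" "K * r \<le> 1" "b * \<Lambda> * r \<le> 1 / 2" by (simp_all add: r_def field_simps)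
  define \<epsilon> where "\<epsilon> = r / (2 * (b + 1))"
  have \<epsilon>: "0 < \<epsilon>" "b * \<epsilon> \<le> r / 2" using r(1) b(1) by (simp_all add: \<epsilon>_def field_simps)
  have "\<exists>x. expsum (flow_coeff x p) 1 = q" if q: "nrm (q - p) < \<epsilon>" for q
  proof -
    define \<Phi> where "\<Phi> x = g (q - p - N x)" for x
    interpret ball: Metric_space "{x. nrm x \<le> r}" "\<lambda>x y. nrm (x - y)" by (rule closed_ball_mcomplete)
    have con: "nrm (\<Phi> x - \<Phi> y) \<le> 1 / 2 * nrm (x - y)" if "nrm x \<le> r" "nrm y \<le> r" for x y
    proof -
      have "\<Phi> x - \<Phi> y = g (N y - N x)" unfolding \<Phi>_def lin_diff[OF g, symmetric] by simp
      then have "nrm (\<Phi> x - \<Phi> y) \<le> b * nrm (N x - N y)" using b(2) nrm_minus_commute by metis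
      also have "\<dots> \<le> b * (\<Lambda> * r * nrm (x - y))"
        using that r b(1) by (intro mult_left_mono N_lip) auto
      also have "\<dots> = (b * \<Lambda> * r) * nrm (x - y)" by simp
      also have "\<dots> \<le> 1 / 2 * nrm (x - y)" by (intro mult_right_mono r) simp
      finally show ?thesis .
    qed
    have "nrm (\<Phi> x) \<le> r" if x: "nrm x \<le> r" for x
    proof -
      have "nrm (\<Phi> 0) \<le> b * nrm (q - p)" using b(2)[of "q - p"] by (simp add: \<Phi>_def N_0)
      also have "\<dots> \<le> b * \<epsilon>" using q b(1) by (intro mult_left_mono) auto
      finally have "nrm (\<Phi> 0) \<le> r / 2" using \<epsilon>(2) by simp
      moreover have "nrm (\<Phi> x - \<Phi> 0) \<le> r / 2" using con[of x 0] x r(1) by simp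
      ultimately show ?thesis using nrm_triangle[of "\<Phi> x - \<Phi> 0" "\<Phi> 0"] by simp
    qed
    then have maps: "\<Phi> \<in> {x. nrm x \<le> r} \<rightarrow> {x. nrm x \<le> r}" by auto
    have nonempty: "{x. nrm x \<le> r} \<noteq> {}" using r(1) by (auto intro!: exI[of _ 0])
    have "nrm (\<Phi> x - \<Phi> y) \<le> 1 / 2 * nrm (x - y)"
      if "x \<in> {x. nrm x \<le> r}" "y \<in> {x. nrm x \<le> r}" for x y
      using that con by blast
    moreover have one_half_lt_one: "1 / 2 < (1 :: real)" by simp
    ultimately obtain x where x: "\<Phi> x = x"
      using ball.Banach_fixedpoint_thm[OF closed_ball_mcomplete(2) nonempty maps one_half_lt_one] by metis
    have "F x p = q - p - N x" using F_g[of "q - p - N x"] x by (simp add: \<Phi>_def)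
    then show ?thesis using flow_split[of x] by (intro exI[of _ x]) simp
  qed
  with \<epsilon>(1) show ?thesis using that by blast
qed

text \<open>
  Being in the same orbit is an equivalence relation with open classes on the real line through \<open>p\<close> and
  \<open>q\<close>, and the line is connected.
\<close>

lemma complete_if_P_nonzero:
  assumes P: "\<And>y. P y \<noteq> 0"
  shows complete
  unfolding complete_def
proof (intro allI)
  fix p q
  define c where "c s = p + of_real s \<cdot> (q - p)" for s :: real
  define reach where "reach s t \<longleftrightarrow> (\<exists>g\<in>G. g (c s) = c t)" for s t
  have "reach 0 1"
  proof (rule connected_equivalence_relation[of "UNIV :: real set"])
    show "reach t s" if "reach s t" for s t
    proof -
      obtain g where g: "g \<in> G" "g (c s) = c t" using \<open>reach s t\<close> unfolding reach_def by blast
      then have "inv_into UNIV g (c t) = c s" using G_bij_P[of g] by (metis bij_is_inj inv_f_f)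
      then show ?thesis unfolding reach_def using G.inverse[OF g(1)] by blast
    qed
    show "reach s w" if "reach s t" "reach t w" for s t w
      using that unfolding reach_def by (metis G.comp o_apply)
    show "\<exists>T. openin (top_of_set UNIV) T \<and> s \<in> T \<and> (\<forall>t\<in>T. reach s t)" for s
    proof -
      obtain \<epsilon> where \<epsilon>: "0 < \<epsilon>" "\<And>z. nrm (z - c s) < \<epsilon> \<Longrightarrow> \<exists>x. expsum (flow_coeff x (c s)) 1 = z"
        using flow_reaches_neighbourhood[OF P] by blast
      define \<delta> where "\<delta> = \<epsilon> / (nrm (q - p) + 1)"
      have pos: "0 < nrm (q - p) + 1" by (simp add: add_nonneg_pos)
      have "reach s t" if t: "t \<in> ball s \<delta>" for t
      proof -
        have "c t - c s = of_real (t - s) \<cdot> (q - p)" by (simp add: c_def scale_left_diff_distrib)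
        then have "nrm (c t - c s) = \<bar>t - s\<bar> * nrm (q - p)" by (simp add: nrm_scale flip: of_real_diff)
        also have "\<dots> \<le> \<bar>t - s\<bar> * (nrm (q - p) + 1)" by (intro mult_left_mono) auto
        also have "\<dots> < \<epsilon>"
          using t pos by (simp add: \<delta>_def dist_real_def pos_less_divide_eq abs_minus_commute)
        finally obtain x where "expsum (flow_coeff x (c s)) 1 = c t" using \<epsilon>(2) by blast
        then show ?thesis
          unfolding reach_def using G.flow[OF is_flow_expsum, of x 1]
          by (intro bexI[of _ "\<lambda>p. expsum (flow_coeff x p) 1"])
      qed
      moreover have "0 < \<delta>" using \<epsilon>(1) pos by (simp add: \<delta>_def)
      ultimately show ?thesis by (intro exI[of _ "ball s \<delta>"]) auto
    qed
  qed auto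
  then show "\<exists>g\<in>G. g p = q" by (simp add: reach_def c_def)
qed

text \<open>
  Completeness is equivalent to the nonvanishing of \<open>P\<close>, and the other three conditions form a cycle
  with it: if \<open>P\<close> does not vanish, then the traces do, hence \<open>P = 1\<close>, hence the right multiplications
  are nilpotent, hence \<open>P\<close> does not vanish.
\<close>

lemma complete_characterizations:
  "(complete \<longleftrightarrow> (\<forall>x. nilpotent_op (R x))) \<and>
   (complete \<longleftrightarrow> (\<forall>x. P x = 1)) \<and>
   (complete \<longleftrightarrow> (\<forall>x. P x \<noteq> 0)) \<and>
   (complete \<longleftrightarrow> (\<forall>x. op_trace (R x) = 0))"
  using P_nonzero_if_complete complete_if_P_nonzero trace_zero_if_P_nonzero P_one_if_trace_zero
    nilpotent_if_P_one P_nonzero_if_nilpotent by (metis)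

end

theorem proposition1:
  fixes smR :: "real \<Rightarrow> 'v::ab_group_add \<Rightarrow> 'v" and mulR :: "'v \<Rightarrow> 'v \<Rightarrow> 'v"
    and smC :: "complex \<Rightarrow> 'w::ab_group_add \<Rightarrow> 'w" and mulC :: "'w \<Rightarrow> 'w \<Rightarrow> 'w"
  shows
    "(left_symmetric_algebra smR mulR \<longrightarrow>
       (left_symmetric_algebra.complete smR mulR \<longleftrightarrow>
          (\<forall>x. nilpotent_op (left_symmetric_algebra.R mulR x))) \<and>
       (left_symmetric_algebra.complete smR mulR \<longleftrightarrow>
          (\<forall>x. left_symmetric_algebra.P smR mulR x = 1)) \<and>
       (left_symmetric_algebra.complete smR mulR \<longleftrightarrow>
          (\<forall>x. left_symmetric_algebra.P smR mulR x \<noteq> 0)) \<and>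
       (left_symmetric_algebra.complete smR mulR \<longleftrightarrow>
          (\<forall>x. finite_dim_space.op_trace smR (left_symmetric_algebra.R mulR x) = 0)))
     \<and>
     (left_symmetric_algebra smC mulC \<longrightarrow>
       (left_symmetric_algebra.complete smC mulC \<longleftrightarrow>
          (\<forall>x. nilpotent_op (left_symmetric_algebra.R mulC x))) \<and>
       (left_symmetric_algebra.complete smC mulC \<longleftrightarrow>
          (\<forall>x. left_symmetric_algebra.P smC mulC x = 1)) \<and>
       (left_symmetric_algebra.complete smC mulC \<longleftrightarrow>
          (\<forall>x. left_symmetric_algebra.P smC mulC x \<noteq> 0)) \<and>
       (left_symmetric_algebra.complete smC mulC \<longleftrightarrow>
          (\<forall>x. finite_dim_space.op_trace smC (left_symmetric_algebra.R mulC x) = 0)))"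
  using banach_left_symmetric_algebra.complete_characterizations[of smR mulR]
    banach_left_symmetric_algebra.complete_characterizations[of smC mulC]
  unfolding banach_left_symmetric_algebra_def by blast

end
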